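(* Let $\mathbb{C}\mathrm{H}(n)=G/H$ with $G=F_rN$ be a non-symmetric homogeneous description, and let $\mathfrak{g}=\mathfrak{h}+\mathfrak{m}$ be a reductive decomposition with associated $\mathfrak{h}$-equivariant maps $\varphi_r:\mathfrak{s}_r\to\mathfrak{h}$ and $\varphi:\mathfrak{s}\to\mathfrak{h}$. Then the Lie algebra $\mathfrak{k}$ of the holonomy group of the canonical connection $\tilde\nabla$ associated with $\mathfrak{g}=\mathfrak{h}+\mathfrak{m}$ is $$\mathfrak{k}=\varphi_r(\mathfrak{n})=\varphi(\mathfrak{n}).$$
   Context: Fix $n\ge1$. $\mathrm{SU}(n,1)$ is the group of determinant-one complex $(n+1)\times(n+1)$ matrices preserving the Hermitian form $\hat h(X,Y)=\overline{Y_1}X_1+\dots+\overline{Y_{n-1}}X_{n-1}+\overline{Y_{n+1}}X_n+\overline{Y_n}X_{n+1}$; $\mathbb{C}\mathrm{H}(n)$ is the space of $\hat h$-negative lines with its invariant Kähler metric, with base point the line spanned by $(0,\dots,0,1,-1)$. Matrices are in blocks of sizes $n-1,1,1$. Put $\mathfrak{s}(\mathfrak{u}(n-1)+\mathfrak{u}(1))=\{\mathrm{diag}(B,ic,ic): B\in\mathfrak{u}(n-1),c\in\mathbb{R},\mathrm{tr}B+2ic=0\}$, with connected group $\mathrm{S}(\mathrm{U}(n-1)\mathrm{U}(1))$; $A_0=\mathrm{diag}(0,\dots,0,1,-1)$, $\mathfrak{a}=\mathbb{R}A_0$, $A=\exp\mathfrak{a}$; $\mathfrak{n}_1=\left\{\begin{pmatrix}0&0&v\\-v^*&0&0\\0&0&0\end{pmatrix}: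 v\in\mathbb{C}^{n-1}\right\}$; $N_2=\begin{pmatrix}0&0&0\\0&0&i\\0&0&0\end{pmatrix}$, $\mathfrak{n}_2=\mathbb{R}N_2$, $\mathfrak{n}=\mathfrak{n}_1+\mathfrak{n}_2$, $N=\exp\mathfrak{n}$. Non-symmetric description: $G=F_rN$, where $F_r$ is a connected closed subgroup of $\mathrm{S}(\mathrm{U}(n-1)\mathrm{U}(1))A$ with non-trivial projection to $A$, and $H=F_r\cap \mathrm{S}(\mathrm{U}(n-1)\mathrm{U}(1))$; $\mathfrak{g},\mathfrak{h},\mathfrak{f}_r$ are the Lie algebras of $G,H,F_r$. Let $\mathfrak{a}_r$ be the orthogonal complement of $\mathfrak{h}$ in $\mathfrak{f}_r$ for $k(E,E')=\mathrm{Re}\,\mathrm{tr}(E^*E')$; it is one-dimensional, $\mathfrak{a}_r=\mathbb{R}A_r$ with $A_r=A_0+H_r$, $H_r\in\mathfrak{s}(\mathfrak{u}(n-1)+\mathfrak{u}(1))$. Put $\mathfrak{s}=\mathfrak{a}+\mathfrak{n}$, $\mathfrak{s}_r=\mathfrak{a}_r+\mathfrak{n}$, and let $\chi_r:\mathfrak{s}\to\mathfrak{s}_r$ be linear, the identity on $\mathfrak{n}$, with $\chi_r(A_0)=A_r$. Given a reductive decomposition $\mathfrak{g}=\mathfrak{h}+\mathfrak{m}$ ($\mathfrak{m}$ an $\mathrm{Ad}(H)$-invariant complement), $\mathfrak{m}$ is the graph $\{Y+\varphi_r(Y):Y\in\mathfrak{s}_r\}$ of a unique $\mathfrak{h}$-equivariant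 linear map $\varphi_r:\mathfrak{s}_r\to\mathfrak{h}$; put $\varphi=\varphi_r\circ\chi_r:\mathfrak{s}\to\mathfrak{h}$. The holonomy algebra of the canonical connection is the subalgebra of $\mathfrak{h}$ generated by $[\mathfrak{m},\mathfrak{m}]_{\mathfrak{h}}$ (acting on $\mathfrak{m}$ by $\mathrm{ad}$). *)

theory Defs
  imports "HOL-Analysis.Analysis" "HOL-Library.FuncSet"
begin

(* The n+1 coordinates are indexed by a finite type 'i.  Two distinct elements p, q of 'i stand for
   the last two coordinates n and n+1; the remaining n-1 indices form the first block, which is
   empty when n = 1.  Only the block structure matters, so no order on the first block is chosen.
   All vector space notions (subspace, linear, orthogonal) are over the reals. *)

type_synonym 'i cmat = "complex^'i^'i"

section \<open>Matrix groups and Lie algebras\<close>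

definition ctranspose :: "'i::finite cmat \<Rightarrow> 'i cmat" where
  "ctranspose E = (\<chi> i j. cnj (E $ j $ i))"

definition mexp :: "'i::finite cmat \<Rightarrow> 'i cmat" where
  "mexp X = (\<Sum>k. (1 / fact k) *\<^sub>R (((**) X ^^ k) (mat 1)))"

definition bracket :: "'i::finite cmat \<Rightarrow> 'i cmat \<Rightarrow> 'i cmat" where
  "bracket X Y = X ** Y - Y ** X"

definition mat_subgroup :: "'i::finite cmat set \<Rightarrow> bool" where
  "mat_subgroup S \<longleftrightarrow> mat 1 \<in> S \<and> (\<forall>x\<in>S. \<forall>y\<in>S. x ** y \<in> S)
     \<and> (\<forall>x\<in>S. invertible x \<and> matrix_inv x \<in> S)"

definition lie_algebra_of :: "'i::finite cmat set \<Rightarrow> 'i cmat set" where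
  "lie_algebra_of S = {X. \<forall>t::real. mexp (t *\<^sub>R X) \<in> S}"

(* The connected Lie group with Lie algebra L is generated by the exponentials of L. *)
definition connected_group :: "'i::finite cmat set \<Rightarrow> 'i cmat set" where
  "connected_group L = mat_subgroup hull (mexp ` L)"

definition lie_subalgebra :: "'i::finite cmat set \<Rightarrow> bool" where
  "lie_subalgebra L \<longleftrightarrow> subspace L \<and> (\<forall>X\<in>L. \<forall>Y\<in>L. bracket X Y \<in> L)"

section \<open>SU(n,1) and complex hyperbolic space\<close>

definition hform :: "'i::finite \<Rightarrow> 'i \<Rightarrow> complex^'i \<Rightarrow> complex^'i \<Rightarrow> complex" where
  "hform p q X Y = (\<Sum>i\<in>UNIV - {p, q}. cnj (Y $ i) * X $ i) + cnj (Y $ q) * X $ p + cnj (Y $ p) * X $ q"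

definition SU :: "'i::finite \<Rightarrow> 'i \<Rightarrow> 'i cmat set" where
  "SU p q = {g. det g = 1 \<and> (\<forall>X Y. hform p q (g *v X) (g *v Y) = hform p q X Y)}"

definition cline :: "complex^'i::finite \<Rightarrow> (complex^'i) set" where
  "cline x = range (\<lambda>c. c *s x)"

definition CH :: "'i::finite \<Rightarrow> 'i \<Rightarrow> (complex^'i) set set" where
  "CH p q = {cline x | x. Re (hform p q x x) < 0}"

definition base_point :: "'i::finite \<Rightarrow> 'i \<Rightarrow> (complex^'i) set" where
  "base_point p q = cline (axis p 1 - axis q 1)"

(* G/H is CH(n) as a homogeneous Riemannian manifold: the metric needs no separate condition, since
   all of SU(n,1) acts on CH(n) by isometries. *)
definition CH_eq_quotient :: "'i::finite \<Rightarrow> 'i \<Rightarrow> 'i cmat set \<Rightarrow> 'i cmat set \<Rightarrow> bool" where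
  "CH_eq_quotient p q G H \<longleftrightarrow> mat_subgroup G \<and> G \<subseteq> SU p q
     \<and> (\<forall>L\<in>CH p q. \<exists>g\<in>G. (\<lambda>x. g *v x) ` base_point p q = L)
     \<and> H = {g\<in>G. (\<lambda>x. g *v x) ` base_point p q = base_point p q}"

section \<open>The standard subalgebras and subgroups\<close>

definition suu_alg :: "'i::finite \<Rightarrow> 'i \<Rightarrow> 'i cmat set" where
  "suu_alg p q = {X. (\<exists>c::real. X $ p $ p = \<i> * c \<and> X $ q $ q = \<i> * c)
     \<and> (\<forall>i j. i \<notin> {p, q} \<longrightarrow> j \<notin> {p, q} \<longrightarrow> cnj (X $ j $ i) = - X $ i $ j)
     \<and> (\<forall>i j. i \<noteq> j \<longrightarrow> i \<in> {p, q} \<or> j \<in> {p, q} \<longrightarrow> X $ i $ j = 0)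
     \<and> trace X = 0}"

definition SUU :: "'i::finite \<Rightarrow> 'i \<Rightarrow> 'i cmat set" where
  "SUU p q = connected_group (suu_alg p q)"

definition A0 :: "'i::finite \<Rightarrow> 'i \<Rightarrow> 'i cmat" where
  "A0 p q = (\<chi> i j. if i = p \<and> j = p then 1 else if i = q \<and> j = q then -1 else 0)"

definition a_alg :: "'i::finite \<Rightarrow> 'i \<Rightarrow> 'i cmat set" where
  "a_alg p q = range (\<lambda>t::real. t *\<^sub>R A0 p q)"

definition A_grp :: "'i::finite \<Rightarrow> 'i \<Rightarrow> 'i cmat set" where
  "A_grp p q = mexp ` a_alg p q"

(* The coordinates v $ p and v $ q are not used: v stands for a vector indexed by the first block. *)
definition n1_mat :: "'i::finite \<Rightarrow> 'i \<Rightarrow> complex^'i \<Rightarrow> 'i cmat" where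
  "n1_mat p q v = (\<chi> i j. if i \<notin> {p, q} \<and> j = q then v $ i
                          else if i = p \<and> j \<notin> {p, q} then - cnj (v $ j) else 0)"

definition n1_alg :: "'i::finite \<Rightarrow> 'i \<Rightarrow> 'i cmat set" where
  "n1_alg p q = range (n1_mat p q)"

definition N2 :: "'i::finite \<Rightarrow> 'i \<Rightarrow> 'i cmat" where
  "N2 p q = (\<chi> i j. if i = p \<and> j = q then \<i> else 0)"

definition n2_alg :: "'i::finite \<Rightarrow> 'i \<Rightarrow> 'i cmat set" where
  "n2_alg p q = range (\<lambda>t::real. t *\<^sub>R N2 p q)"

definition n_alg :: "'i::finite \<Rightarrow> 'i \<Rightarrow> 'i cmat set" where
  "n_alg p q = {X + Y | X Y. X \<in> n1_alg p q \<and> Y \<in> n2_alg p q}"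

definition N_grp :: "'i::finite \<Rightarrow> 'i \<Rightarrow> 'i cmat set" where
  "N_grp p q = mexp ` n_alg p q"

section \<open>Non-symmetric homogeneous descriptions\<close>

definition SUU_A :: "'i::finite \<Rightarrow> 'i \<Rightarrow> 'i cmat set" where
  "SUU_A p q = {k ** a | k a. k \<in> SUU p q \<and> a \<in> A_grp p q}"

definition proj_A :: "'i::finite \<Rightarrow> 'i \<Rightarrow> 'i cmat set \<Rightarrow> 'i cmat set" where
  "proj_A p q F = {a \<in> A_grp p q. \<exists>k\<in>SUU p q. k ** a \<in> F}"

definition nonsymmetric_description ::
    "'i::finite \<Rightarrow> 'i \<Rightarrow> 'i cmat set \<Rightarrow> 'i cmat set \<Rightarrow> 'i cmat set \<Rightarrow> bool" where
  "nonsymmetric_description p q F G H \<longleftrightarrow>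
     mat_subgroup F \<and> F \<subseteq> SUU_A p q \<and> closedin (top_of_set (SUU_A p q)) F \<and> connected F
     \<and> proj_A p q F \<noteq> {mat 1}
     \<and> G = {f ** u | f u. f \<in> F \<and> u \<in> N_grp p q}
     \<and> H = F \<inter> SUU p q"

definition kform :: "'i::finite cmat \<Rightarrow> 'i cmat \<Rightarrow> real" where
  "kform E E' = Re (trace (ctranspose E ** E'))"

definition ar_alg :: "'i::finite cmat set \<Rightarrow> 'i cmat set \<Rightarrow> 'i cmat set" where
  "ar_alg F H = {E \<in> lie_algebra_of F. \<forall>E'\<in>lie_algebra_of H. kform E E' = 0}"

definition Ar :: "'i::finite \<Rightarrow> 'i \<Rightarrow> 'i cmat set \<Rightarrow> 'i cmat set \<Rightarrow> 'i cmat" where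
  "Ar p q F H = (THE X. ar_alg F H = range (\<lambda>t::real. t *\<^sub>R X) \<and> X - A0 p q \<in> suu_alg p q)"

definition s_alg :: "'i::finite \<Rightarrow> 'i \<Rightarrow> 'i cmat set" where
  "s_alg p q = {X + Y | X Y. X \<in> a_alg p q \<and> Y \<in> n_alg p q}"

definition sr_alg :: "'i::finite \<Rightarrow> 'i \<Rightarrow> 'i cmat set \<Rightarrow> 'i cmat set \<Rightarrow> 'i cmat set" where
  "sr_alg p q F H = {X + Y | X Y. X \<in> ar_alg F H \<and> Y \<in> n_alg p q}"

(* Extensional, so that such a map is determined by its values on V. *)
definition linear_maps :: "'i::finite cmat set \<Rightarrow> 'i cmat set \<Rightarrow> ('i cmat \<Rightarrow> 'i cmat) set" where
  "linear_maps V W = {f \<in> V \<rightarrow>\<^sub>E W. (\<forall>X\<in>V. \<forall>Y\<in>V. f (X + Y) = f X + f Y)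
     \<and> (\<forall>X\<in>V. \<forall>t::real. f (t *\<^sub>R X) = t *\<^sub>R f X)}"

definition chi_r :: "'i::finite \<Rightarrow> 'i \<Rightarrow> 'i cmat set \<Rightarrow> 'i cmat set \<Rightarrow> 'i cmat \<Rightarrow> 'i cmat" where
  "chi_r p q F H = (THE f. f \<in> linear_maps (s_alg p q) (sr_alg p q F H)
     \<and> (\<forall>Z\<in>n_alg p q. f Z = Z) \<and> f (A0 p q) = Ar p q F H)"

section \<open>Reductive decompositions and holonomy\<close>

definition reductive_decomposition :: "'i::finite cmat set \<Rightarrow> 'i cmat set \<Rightarrow> 'i cmat set \<Rightarrow> bool" where
  "reductive_decomposition G H M \<longleftrightarrow> subspace M \<and> M \<subseteq> lie_algebra_of G
     \<and> lie_algebra_of H \<inter> M = {0}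
     \<and> lie_algebra_of G = {X + Y | X Y. X \<in> lie_algebra_of H \<and> Y \<in> M}
     \<and> (\<forall>x\<in>H. \<forall>Y\<in>M. x ** Y ** matrix_inv x \<in> M)"

definition phi_r ::
    "'i::finite \<Rightarrow> 'i \<Rightarrow> 'i cmat set \<Rightarrow> 'i cmat set \<Rightarrow> 'i cmat set \<Rightarrow> 'i cmat \<Rightarrow> 'i cmat" where
  "phi_r p q F H M = (THE f. f \<in> linear_maps (sr_alg p q F H) (lie_algebra_of H)
     \<and> (\<forall>X\<in>lie_algebra_of H. \<forall>Y\<in>sr_alg p q F H. f (bracket X Y) = bracket X (f Y))
     \<and> M = {Y + f Y | Y. Y \<in> sr_alg p q F H})"

definition phi ::
    "'i::finite \<Rightarrow> 'i \<Rightarrow> 'i cmat set \<Rightarrow> 'i cmat set \<Rightarrow> 'i cmat set \<Rightarrow> 'i cmat \<Rightarrow> 'i cmat" where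
  "phi p q F H M = compose (s_alg p q) (phi_r p q F H M) (chi_r p q F H)"

definition h_part :: "'i::finite cmat set \<Rightarrow> 'i cmat set \<Rightarrow> 'i cmat \<Rightarrow> 'i cmat" where
  "h_part H M Z = (THE X. X \<in> lie_algebra_of H \<and> Z - X \<in> M)"

(* The isotropy representation of the Lie algebra of H on M is faithful, so the holonomy algebra is
   taken inside the Lie algebra of H rather than as its image in gl(M). *)
definition holonomy_algebra :: "'i::finite cmat set \<Rightarrow> 'i cmat set \<Rightarrow> 'i cmat set" where
  "holonomy_algebra H M = lie_subalgebra hull {h_part H M (bracket X Y) | X Y. X \<in> M \<and> Y \<in> M}"

end

theory Submission
  imports Defs
begin

text \<open>Write \<open>f\<close>, \<open>h\<close>, \<open>g\<close> for the Lie algebras of F, H, G.  Von Neumann's argument shows that \<open>f\<close> is a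
  Lie algebra whose exponentials fill a neighbourhood of 1 in F; as F is connected and projects
  non-trivially to A, \<open>f\<close> is not contained in the compact part \<open>s(u(n-1)+u(1))\<close>, so it is \<open>h\<close> plus
  the line through \<open>A_r\<close>, and \<open>A_r\<close> commutes with \<open>h\<close>.  Projecting one-parameter groups of G to their
  block diagonal part gives \<open>g = f + n\<close>.

  For \<open>x = Y + \<phi>Y\<close> and \<open>x' = Y' + \<phi>Y'\<close> in M, equivariance turns \<open>[\<phi>Y, \<phi>Y']\<close> into \<open>\<phi>[\<phi>Y, Y']\<close>, and
  the h-part of \<open>[x, x']\<close> becomes \<open>-\<phi>([Y, Y'] + [\<phi>Y, Y'])\<close>, which lies in \<open>\<phi>(n)\<close>, a subalgebra by the
  same identity.  Every element of \<open>\<phi>(n)\<close> arises with \<open>Y = A_r\<close>, because \<open>ad(A_r + \<phi>A_r)\<close> is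
  \<open>ad A_0\<close> plus a skew-symmetric operator on n, hence positive definite there.\<close>

section \<open>Exponentials in the algebra of bounded operators\<close>

text \<open>The closed-subgroup theorem does not apply as usual, because F is closed only relative
  to \<open>SUU_A p q\<close>. Closedness therefore enters through a weaker condition: one-parameter
  groups inside \<open>closure F\<close> already lie in F. It holds because their generators are
  block diagonal elements of su(n,1), whose exponentials return to \<open>SUU_A p q\<close>. For G
  no closedness is established; \<open>lie_algebra_of G\<close> receives its linear structure only
  as the sum of h and M. S(U(n-1)U(1)) is given by generators, so its elements are controlled
  through the linear space \<open>eq_block_diag\<close>, which contains it and meets A only in 1.
  \<open>Ar\<close>, \<open>chi_r\<close> and \<open>phi_r\<close> are definite descriptions, so
  existence and uniqueness have to be shown before their properties can be read off. For
  \<open>phi_r\<close> both come from \<open>h_part\<close>, the projection to h along M. Positivity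
  of ad on n is measured by \<open>kform\<close>, the real Euclidean product of matrices, for which
  ad of s(u(n-1)+u(1)) is skew.\<close>

text \<open>A copy of the bounded endomorphisms with composition as \<open>*\<close>, so that the exponential of
  Banach algebras applies; on the matrix type itself \<open>*\<close> is the componentwise product.\<close>

typedef (overloaded) 'a endo = "UNIV :: ('a::real_normed_vector \<Rightarrow>\<^sub>L 'a) set"
  morphisms map_of endo_of ..

setup_lifting type_definition_endo

instantiation endo :: (real_normed_vector) real_normed_vector
begin
lift_definition zero_endo :: "'a endo" is 0 .
lift_definition plus_endo :: "'a endo \<Rightarrow> 'a endo \<Rightarrow> 'a endo" is "(+)" .
lift_definition minus_endo :: "'a endo \<Rightarrow> 'a endo \<Rightarrow> 'a endo" is "(-)" .
lift_definition uminus_endo :: "'a endo \<Rightarrow> 'a endo" is uminus .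
lift_definition scaleR_endo :: "real \<Rightarrow> 'a endo \<Rightarrow> 'a endo" is "(*\<^sub>R)" .
lift_definition norm_endo :: "'a endo \<Rightarrow> real" is norm .
definition dist_endo :: "'a endo \<Rightarrow> 'a endo \<Rightarrow> real" where "dist_endo x y = norm (x - y)"
definition "(uniformity :: ('a endo \<times> 'a endo) filter) =
  (INF e\<in>{0 <..}. principal {(x, y). dist x y < e})"
definition open_endo :: "'a endo set \<Rightarrow> bool"
  where "open_endo S = (\<forall>x\<in>S. \<forall>\<^sub>F (x', y) in uniformity. x' = x \<longrightarrow> y \<in> S)"
definition sgn_endo :: "'a endo \<Rightarrow> 'a endo" where "sgn_endo x = scaleR (inverse (norm x)) x"
instance
  by standard (transfer; simp add: dist_endo_def sgn_endo_def uniformity_endo_def open_endo_def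
      algebra_simps norm_triangle_ineq)+
end

instance endo :: (banach) banach
proof
  fix X :: "nat \<Rightarrow> 'a endo"
  have dist_map_of: "dist x y = dist (map_of x) (map_of y)" for x y :: "'a endo"
    unfolding dist_endo_def dist_norm by transfer simp
  assume "Cauchy X"
  then have "Cauchy (\<lambda>n. map_of (X n))"
    by (simp add: Cauchy_def dist_map_of)
  then obtain L where "(\<lambda>n. map_of (X n)) \<longlonglongrightarrow> L"
    using Cauchy_convergent convergent_def by blast
  then have "X \<longlonglongrightarrow> endo_of L"
    by (simp add: tendsto_iff dist_map_of endo_of_inverse)
  then show "convergent X"
    by (auto simp: convergent_def)
qed

instantiation endo :: ("{perfect_space, real_normed_vector}") real_normed_algebra_1
begin
lift_definition one_endo :: "'a endo" is id_blinfun .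
lift_definition times_endo :: "'a endo \<Rightarrow> 'a endo \<Rightarrow> 'a endo" is blinfun_compose .
instance
proof
  show "norm (x * y) \<le> norm x * norm y" for x y :: "'a endo"
    by transfer (rule norm_blinfun_compose)
  show "norm (1 :: 'a endo) = 1"
    by transfer simp
  then show "(0 :: 'a endo) \<noteq> 1"
    by (metis norm_zero zero_neq_one)
qed (transfer; auto intro!: blinfun_eqI simp: blinfun.bilinear_simps)+
end

section \<open>Norm estimates and limits for the exponential of a Banach algebra\<close>

lemma norm_power_Suc_diff_le:
  fixes x y :: "'a::real_normed_algebra_1"
  assumes "norm x \<le> c" "norm y \<le> c"
  shows "norm (x ^ Suc n - y ^ Suc n) \<le> real (Suc n) * c ^ n * norm (x - y)"
proof (induction n)
  case (Suc n)
  have c: "0 \<le> c"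
    using assms(1) norm_ge_zero order_trans by blast
  \<comment> \<open>Telescoping keeps the factors in order, as x and y need not commute. Starting
    the statement at exponent \<open>Suc n\<close> keeps the power \<open>c ^ n\<close> free of
    truncated subtraction.\<close>
  have "x ^ Suc (Suc n) - y ^ Suc (Suc n) = x * (x ^ Suc n - y ^ Suc n) + (x - y) * y ^ Suc n"
    by (simp add: algebra_simps)
  also have "norm \<dots> \<le> norm x * norm (x ^ Suc n - y ^ Suc n) + norm (x - y) * norm (y ^ Suc n)"
    by (intro norm_triangle_le add_mono norm_mult_ineq)
  also have "\<dots> \<le> c * (real (Suc n) * c ^ n * norm (x - y)) + norm (x - y) * c ^ Suc n"
    using assms c Suc
    by (intro add_mono mult_mono order_trans[OF norm_power_ineq] power_mono) auto
  also have "\<dots> = real (Suc (Suc n)) * c ^ Suc n * norm (x - y)"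
    by (simp add: algebra_simps)
  finally show ?case .
qed simp

text \<open>Strict differentiability of exp at 0. Once the terms of degree 0 and 1 are removed, the
  term of degree n + 2 has Lipschitz constant (n + 2) r^(n+1) / (n + 2)! = r^(n+1) / (n + 1)!, and
  these constants sum to exp r - 1, which vanishes with r.\<close>

lemma norm_exp_diff_le:
  fixes x y :: "'a::{real_normed_algebra_1,banach}"
  assumes "norm x \<le> r" "norm y \<le> r"
  shows "norm (exp x - exp y - (x - y)) \<le> (exp r - 1) * norm (x - y)"
proof -
  define f where "f n = (x ^ n - y ^ n) /\<^sub>R fact n" for n
  have "f sums (exp x - exp y)"
    unfolding f_def scaleR_diff_right by (intro sums_diff exp_converges)
  then have "(\<lambda>n. f (n + 2)) sums (exp x - exp y - (\<Sum>i<2. f i))"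
    by (rule sums_split_initial_segment)
  moreover have "(\<Sum>i<2. f i) = x - y"
    by (simp add: f_def numeral_2_eq_2)
  ultimately have F: "(\<lambda>n. f (n + 2)) sums (exp x - exp y - (x - y))"
    by simp
  have "(\<lambda>n. r ^ (n + 1) /\<^sub>R fact (n + 1)) sums (exp r - (\<Sum>i<1. r ^ i /\<^sub>R fact i))"
    by (intro sums_split_initial_segment exp_converges)
  then have G: "(\<lambda>n. r ^ (n + 1) /\<^sub>R fact (n + 1) * norm (x - y)) sums ((exp r - 1) * norm (x - y))"
    by (intro sums_mult2) simp
  have "norm (f (n + 2)) \<le> r ^ (n + 1) /\<^sub>R fact (n + 1) * norm (x - y)" for n
  proof -
    have "norm (f (n + 2)) = norm (x ^ Suc (Suc n) - y ^ Suc (Suc n)) / fact (Suc (Suc n))"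
      by (simp add: f_def divide_inverse mult.commute del: power_Suc)
    also have "\<dots> \<le> (real (Suc (Suc n)) * r ^ Suc n * norm (x - y)) / fact (Suc (Suc n))"
      by (intro divide_right_mono norm_power_Suc_diff_le assms) auto
    also have "\<dots> = r ^ (n + 1) /\<^sub>R fact (n + 1) * norm (x - y)"
      by (simp add: divide_inverse del: of_nat_Suc)
    finally show ?thesis .
  qed
  then show ?thesis
    by (rule norm_sums_le[OF F G])
qed

lemma exp_scaleR_of_nat:
  fixes x :: "'a::{real_normed_algebra_1,banach}"
  shows "exp (real n *\<^sub>R x) = exp x ^ n"
proof (induction n)
  case (Suc n)
  have "exp (real (Suc n) *\<^sub>R x) = exp (x + real n *\<^sub>R x)"
    by (simp add: scaleR_add_left)
  also have "\<dots> = exp x * exp (real n *\<^sub>R x)"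
    by (rule exp_add_commuting) simp
  finally show ?case
    using Suc by simp
qed simp

lemma tendsto_exp_diff_quotient:
  fixes x :: "'a::{real_normed_algebra_1,banach}"
  assumes s: "s \<longlonglongrightarrow> 0" and pos: "\<And>j. (0::real) < s j"
  shows "(\<lambda>j. (exp (s j *\<^sub>R x) - 1) /\<^sub>R s j) \<longlonglongrightarrow> x"
proof (rule LIM_zero_cancel, rule Lim_null_comparison)
  show "\<forall>\<^sub>F j in sequentially.
      norm ((exp (s j *\<^sub>R x) - 1) /\<^sub>R s j - x) \<le> (exp (s j * norm x) - 1) * norm x"
  proof (rule always_eventually, rule allI)
    fix j
    have "(exp (s j *\<^sub>R x) - 1) /\<^sub>R s j - x = (exp (s j *\<^sub>R x) - exp 0 - (s j *\<^sub>R x - 0)) /\<^sub>R s j"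
      using pos[of j] by (simp add: algebra_simps)
    also have "norm \<dots> \<le> ((exp (s j * norm x) - 1) * norm (s j *\<^sub>R x - 0)) / s j"
      using pos[of j] norm_exp_diff_le[of "s j *\<^sub>R x" "s j * norm x" 0]
      by (simp add: divide_inverse_commute mult_left_mono)
    also have "\<dots> = (exp (s j * norm x) - 1) * norm x"
      using pos[of j] by simp
    finally show "norm ((exp (s j *\<^sub>R x) - 1) /\<^sub>R s j - x) \<le> (exp (s j * norm x) - 1) * norm x" .
  qed
  have "(\<lambda>j. (exp (s j * norm x) - 1) * norm x) \<longlonglongrightarrow> (exp (0 * norm x) - 1) * norm x"
    by (intro tendsto_intros s)
  then show "(\<lambda>j. (exp (s j * norm x) - 1) * norm x) \<longlonglongrightarrow> 0"
    by simp
qed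

text \<open>Euler's limit for arbitrary elements 1 + s x + o(s). Both g j and the exponential of s j
  x have norm at most exp (K s j), so telescoping over m j factors costs at most t exp (K t) times
  the difference of the two difference quotients, which tends to 0.\<close>

lemma power_tendsto_exp:
  fixes x :: "'a::{real_normed_algebra_1,banach}"
  assumes s: "s \<longlonglongrightarrow> 0" and pos: "\<And>j. (0::real) < s j"
    and lim: "(\<lambda>j. (g j - 1) /\<^sub>R s j) \<longlonglongrightarrow> x" and t: "0 \<le> t"
  shows "(\<lambda>j. g j ^ nat \<lfloor>t / s j\<rfloor>) \<longlonglongrightarrow> exp (t *\<^sub>R x)"
proof -
  define m where "m j = nat \<lfloor>t / s j\<rfloor>" for j
  \<comment> \<open>The extra 1 puts K strictly above the norm of the limit, so K eventually bounds
    the quotients themselves.\<close>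
  define K where "K = norm x + 1"
  have m_le: "real (m j) * s j \<le> t" and m_ge: "t - s j \<le> real (m j) * s j" for j
  proof -
    have "real (m j) = of_int \<lfloor>t / s j\<rfloor>"
      using t pos[of j] by (simp add: m_def)
    then have "real (m j) \<le> t / s j" "t / s j - 1 \<le> real (m j)"
      by linarith+
    then show "real (m j) * s j \<le> t" "t - s j \<le> real (m j) * s j"
      using pos[of j] by (simp_all add: field_simps)
  qed
  have "(\<lambda>j. real (m j) * s j) \<longlonglongrightarrow> t"
  proof (rule tendsto_sandwich)
    show "(\<lambda>j. t - s j) \<longlonglongrightarrow> t"
      using tendsto_diff[OF tendsto_const s] by simp
  qed (use m_le m_ge in auto)
  then have "(\<lambda>j. exp ((real (m j) * s j) *\<^sub>R x)) \<longlonglongrightarrow> exp (t *\<^sub>R x)"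
    using has_vector_derivative_continuous[OF exp_scaleR_has_vector_derivative_right]
    by (rule isCont_tendsto_compose[rotated])
  moreover have "exp ((real (m j) * s j) *\<^sub>R x) = exp (s j *\<^sub>R x) ^ m j" for j
    using exp_scaleR_of_nat[of "m j" "s j *\<^sub>R x"] by simp
  ultimately have "(\<lambda>j. exp (s j *\<^sub>R x) ^ m j) \<longlonglongrightarrow> exp (t *\<^sub>R x)"
    by simp
  moreover have "(\<lambda>j. g j ^ m j - exp (s j *\<^sub>R x) ^ m j) \<longlonglongrightarrow> 0"
  proof (rule Lim_null_comparison)
    have "(\<lambda>j. norm ((g j - 1) /\<^sub>R s j)) \<longlonglongrightarrow> norm x"
      by (intro tendsto_intros lim)
    then have "\<forall>\<^sub>F j in sequentially. norm ((g j - 1) /\<^sub>R s j) < K"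
      by (rule order_tendstoD) (simp add: K_def)
    then show "\<forall>\<^sub>F j in sequentially. norm (g j ^ m j - exp (s j *\<^sub>R x) ^ m j)
        \<le> t * exp (K * t) * norm ((g j - 1) /\<^sub>R s j - (exp (s j *\<^sub>R x) - 1) /\<^sub>R s j)"
    proof eventually_elim
      fix j
      assume "norm ((g j - 1) /\<^sub>R s j) < K"
      then have "inverse (s j) * norm (g j - 1) < K"
        using pos[of j] by simp
      then have "norm (g j - 1) \<le> K * s j"
        using pos[of j] by (simp add: field_simps)
      then have "norm (g j) \<le> 1 + K * s j"
        using norm_triangle_ineq[of 1 "g j - 1"] by simp
      then have g: "norm (g j) \<le> exp (K * s j)"
        using exp_ge_add_one_self[of "K * s j"] by linarith
      have e: "norm (exp (s j *\<^sub>R x)) \<le> exp (K * s j)"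
        using pos[of j] by (intro order_trans[OF norm_exp]) (simp add: K_def algebra_simps)
      have K: "0 \<le> K"
        by (simp add: K_def)
      show "norm (g j ^ m j - exp (s j *\<^sub>R x) ^ m j)
        \<le> t * exp (K * t) * norm ((g j - 1) /\<^sub>R s j - (exp (s j *\<^sub>R x) - 1) /\<^sub>R s j)"
      proof (cases "m j")
        case 0
        then show ?thesis using t by simp
      next
        case (Suc n)
        have "norm (g j ^ m j - exp (s j *\<^sub>R x) ^ m j)
            \<le> real (m j) * exp (K * s j) ^ n * norm (g j - exp (s j *\<^sub>R x))"
          using norm_power_Suc_diff_le[OF g e] Suc by simp
        also have "exp (K * s j) ^ n = exp (K * (real n * s j))"
          by (simp flip: exp_of_nat_mult add: mult_ac)
        also have "real n * s j \<le> t"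
          using m_le[of j] pos[of j] by (simp add: Suc algebra_simps)
        then have "real (m j) * exp (K * (real n * s j)) * norm (g j - exp (s j *\<^sub>R x))
            \<le> (t / s j) * exp (K * t) * norm (g j - exp (s j *\<^sub>R x))"
          using K m_le[of j] pos[of j] t by (intro mult_mono) (auto simp: field_simps mult_left_mono)
        also have "\<dots> = t * exp (K * t) * norm ((g j - exp (s j *\<^sub>R x)) /\<^sub>R s j)"
          using pos[of j] by (simp add: divide_inverse)
        also have "(g j - exp (s j *\<^sub>R x)) /\<^sub>R s j = (g j - 1) /\<^sub>R s j - (exp (s j *\<^sub>R x) - 1) /\<^sub>R s j"
          by (simp add: algebra_simps)
        finally show ?thesis .
      qed
    qed
    have "(\<lambda>j. t * exp (K * t) * norm ((g j - 1) /\<^sub>R s j - (exp (s j *\<^sub>R x) - 1) /\<^sub>R s j))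
        \<longlonglongrightarrow> t * exp (K * t) * norm (x - x)"
      by (intro tendsto_intros lim tendsto_exp_diff_quotient s pos)
    then show "(\<lambda>j. t * exp (K * t) * norm ((g j - 1) /\<^sub>R s j - (exp (s j *\<^sub>R x) - 1) /\<^sub>R s j)) \<longlonglongrightarrow> 0"
      by simp
  qed
  ultimately have "(\<lambda>j. g j ^ m j) \<longlonglongrightarrow> exp (t *\<^sub>R x)"
    using tendsto_add[of "\<lambda>j. g j ^ m j - exp (s j *\<^sub>R x) ^ m j" 0] by fastforce
  then show ?thesis
    by (simp add: m_def)
qed

section \<open>The matrix exponential\<close>

definition to_endo :: "'i::finite cmat \<Rightarrow> (complex^'i) endo" where
  "to_endo A = endo_of (Blinfun ((*v) A))"

text \<open>Only a left inverse of \<open>to_endo\<close>: elements of \<open>endo\<close> are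
  bounded real linear maps, and not all of them come from complex matrices. It carries limits and
  estimates back to matrices.\<close>

definition from_endo :: "(complex^'i::finite) endo \<Rightarrow> 'i cmat" where
  "from_endo e = (\<chi> i j. map_of e (axis j 1) $ i)"

lemma map_of_to_endo [simp]: "map_of (to_endo A) x = A *v x"
proof -
  have "linear ((*v) A)"
    by (rule linearI) (simp_all add: vec_eq_iff
        matrix_vector_mult_def scaleR_sum_right sum.distrib distrib_left distrib_right)
  then show ?thesis
    by (simp add: to_endo_def endo_of_inverse bounded_linear_Blinfun_apply
        linear_conv_bounded_linear)
qed

lemma endo_eqI: "(\<And>x. map_of e x = map_of f x) \<Longrightarrow> e = f"
  by transfer (rule blinfun_eqI)

lemma matrix_vector_axis: "(A *v axis j 1) $ i = (A :: 'i::finite cmat) $ i $ j"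
  by (simp add: matrix_vector_mult_def axis_def if_distrib cong: if_cong)

lemma from_endo_to_endo [simp]: "from_endo (to_endo A) = A"
  by (simp add: from_endo_def vec_eq_iff matrix_vector_axis)

lemma to_endo_mult: "to_endo (A ** B) = to_endo A * to_endo B"
  by (rule endo_eqI) (simp add: times_endo.rep_eq matrix_vector_mul_assoc)

lemma to_endo_one: "to_endo (mat 1) = 1"
  by (rule endo_eqI) (simp add: one_endo.rep_eq)

lemma bounded_linear_to_endo: "bounded_linear to_endo"
  by (subst linear_conv_bounded_linear[symmetric], rule linearI; rule endo_eqI)
     (simp_all add: plus_endo.rep_eq scaleR_endo.rep_eq blinfun.bilinear_simps
        matrix_vector_mult_def vec_eq_iff scaleR_sum_right sum.distrib distrib_left distrib_right)

lemma bounded_linear_from_endo: "bounded_linear (from_endo :: (complex^'i::finite) endo \<Rightarrow> _)"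
proof (rule bounded_linear_intro)
  fix e :: "(complex^'i) endo"
  have "norm (from_endo e) \<le> (\<Sum>i\<in>UNIV. norm (from_endo e $ i))"
    unfolding norm_vec_def[of "from_endo e"] by (rule L2_set_le_sum) simp
  also have "\<dots> \<le> (\<Sum>i\<in>UNIV. \<Sum>j\<in>UNIV. norm (from_endo e $ i $ j))"
    by (rule sum_mono, subst norm_vec_def) (rule L2_set_le_sum, simp)
  also have "\<dots> \<le> (\<Sum>i\<in>(UNIV::'i set). \<Sum>j\<in>(UNIV::'i set). norm e)"
  proof (intro sum_mono)
    fix i j
    have "norm (from_endo e $ i $ j) \<le> norm (map_of e (axis j 1))"
      unfolding from_endo_def by (simp add: Finite_Cartesian_Product.norm_nth_le)
    also have "\<dots> \<le> norm (map_of e) * norm (axis j 1 :: complex^'i)"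
      by (rule norm_blinfun)
    finally show "norm (from_endo e $ i $ j) \<le> norm e"
      by (simp add: norm_endo.rep_eq)
  qed
  finally show "norm (from_endo e) \<le> norm e * (real CARD('i) * real CARD('i))"
    by (simp add: algebra_simps)
qed (simp_all add: from_endo_def vec_eq_iff plus_endo.rep_eq scaleR_endo.rep_eq blinfun.bilinear_simps)

lemma tendsto_to_endo_iff: "((\<lambda>x. to_endo (g x)) \<longlongrightarrow> to_endo A) F \<longleftrightarrow> (g \<longlongrightarrow> A) F"
  using bounded_linear.tendsto[OF bounded_linear_to_endo]
    bounded_linear.tendsto[OF bounded_linear_from_endo, of "\<lambda>x. to_endo (g x)" "to_endo A" F]
  by auto

lemma to_endo_matpow: "to_endo (((**) X ^^ k) (mat 1)) = to_endo X ^ k"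
  by (induction k) (simp_all add: to_endo_one to_endo_mult)

lemma mexp_sums: "(\<lambda>k. (1 / fact k) *\<^sub>R (((**) X ^^ k) (mat 1))) sums from_endo (exp (to_endo X))"
proof -
  have "(\<lambda>k. from_endo (to_endo X ^ k /\<^sub>R fact k)) sums from_endo (exp (to_endo X))"
    by (rule bounded_linear.sums[OF bounded_linear_from_endo exp_converges])
  moreover have "from_endo (to_endo X ^ k /\<^sub>R fact k) = (1 / fact k) *\<^sub>R (((**) X ^^ k) (mat 1))" for k
    by (simp add: linear_cmul[OF bounded_linear.linear[OF bounded_linear_from_endo]]
        to_endo_matpow[symmetric] divide_inverse)
  ultimately show ?thesis
    by simp
qed

lemma mexp_converges: "(\<lambda>k. (1 / fact k) *\<^sub>R (((**) X ^^ k) (mat 1))) sums mexp X"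
  unfolding mexp_def using mexp_sums by (rule summable_sums[OF sums_summable])

lemma to_endo_mexp: "to_endo (mexp X) = exp (to_endo X)"
proof -
  have "(\<lambda>k. to_endo ((1 / fact k) *\<^sub>R (((**) X ^^ k) (mat 1)))) sums to_endo (mexp X)"
    by (rule bounded_linear.sums[OF bounded_linear_to_endo mexp_converges])
  moreover have "to_endo ((1 / fact k) *\<^sub>R (((**) X ^^ k) (mat 1))) = to_endo X ^ k /\<^sub>R fact k" for k
    by (simp add: linear_cmul[OF bounded_linear.linear[OF bounded_linear_to_endo]]
        to_endo_matpow divide_inverse)
  ultimately show ?thesis
    using sums_unique2[OF _ exp_converges] by simp
qed

lemmas to_endo_linear = bounded_linear.linear[OF bounded_linear_to_endo]

lemmas to_endo_simps = linear_cmul[OF to_endo_linear] linear_add[OF to_endo_linear]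
  linear_diff[OF to_endo_linear] linear_neg[OF to_endo_linear] linear_0[OF to_endo_linear]
  to_endo_mult to_endo_one to_endo_mexp

lemma to_endo_inject [simp]: "to_endo A = to_endo B \<longleftrightarrow> A = B"
  by (metis from_endo_to_endo)

lemma mexp_0 [simp]: "mexp 0 = mat 1"
  by (subst to_endo_inject[symmetric]) (simp add: to_endo_simps)

lemma mexp_add_commuting:
  assumes "X ** Y = Y ** X"
  shows "mexp (X + Y) = mexp X ** mexp Y"
proof -
  have "to_endo X * to_endo Y = to_endo Y * to_endo X"
    using assms by (simp flip: to_endo_mult)
  then show ?thesis
    by (subst to_endo_inject[symmetric]) (simp add: to_endo_simps exp_add_commuting)
qed

lemma bounded_bilinear_matrix_mult:
  "bounded_bilinear ((**) :: 'i::finite cmat \<Rightarrow> 'i cmat \<Rightarrow> 'i cmat)"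
proof (rule bilinear_conv_bounded_bilinear[THEN iffD1], unfold bilinear_def, intro conjI allI)
  fix X :: "'i cmat"
  show "linear ((**) X)"
    by (rule linearI) (simp_all add: matrix_matrix_mult_def vec_eq_iff scaleR_sum_right sum.distrib distrib_left distrib_right)
  show "linear (\<lambda>Y. Y ** X)"
    by (rule linearI) (simp_all add: matrix_matrix_mult_def vec_eq_iff scaleR_sum_right sum.distrib distrib_left distrib_right)
qed

interpretation mm: bounded_bilinear "(**) :: 'i::finite cmat \<Rightarrow> 'i cmat \<Rightarrow> 'i cmat"
  by (rule bounded_bilinear_matrix_mult)

lemma mexp_minus_mult [simp]: "mexp (- X) ** mexp X = mat 1" "mexp X ** mexp (- X) = mat 1"
  using mexp_add_commuting[of "-X" X, symmetric] mexp_add_commuting[of X "-X", symmetric]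
  by (simp_all add: mm.minus_left mm.minus_right)

lemma matrix_inv_mult:
  fixes A :: "'a::semiring_1^'n^'m"
  assumes "invertible A"
  shows "A ** matrix_inv A = mat 1" "matrix_inv A ** A = mat 1"
  using assms unfolding invertible_def matrix_inv_def by (rule someI2_ex, simp)+

lemma matrix_inv_unique:
  fixes A :: "'a::field^'n^'n"
  assumes "A ** B = mat 1"
  shows "matrix_inv A = B"
proof -
  have "invertible A"
    using assms invertible_right_inverse by blast
  then have "matrix_inv A ** A = mat 1"
    by (rule matrix_inv_mult)
  then have "matrix_inv A ** (A ** B) = B"
    by (simp add: matrix_mul_assoc)
  then show ?thesis
    using assms by simp
qed

lemma invertible_mexp [simp]: "invertible (mexp X)"
  using mexp_minus_mult invertible_def by blast

lemma matrix_inv_mexp [simp]: "matrix_inv (mexp X) = mexp (- X)"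
  by (rule matrix_inv_unique) simp

lemma mexp_diff_quotient:
  assumes "s \<longlonglongrightarrow> 0" and "\<And>j. (0::real) < s j"
  shows "(\<lambda>j. (mexp (s j *\<^sub>R X) - mat 1) /\<^sub>R s j) \<longlonglongrightarrow> X"
  using tendsto_exp_diff_quotient[OF assms, of "to_endo X"]
  by (subst tendsto_to_endo_iff[symmetric]) (simp add: to_endo_simps)

lemma mexp_strict_differentiable:
  assumes "0 < e"
  obtains r where "0 < r" and "\<And>X Y :: 'i::finite cmat. norm X \<le> r \<Longrightarrow> norm Y \<le> r \<Longrightarrow>
    norm (mexp X - mexp Y - (X - Y)) \<le> e * norm (X - Y)"
proof -
  obtain a where a: "0 < a" "\<And>X :: 'i cmat. norm (to_endo X) \<le> norm X * a"
    using bounded_linear.pos_bounded[OF bounded_linear_to_endo] by blast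
  obtain b where b: "0 < b" "\<And>x :: (complex^'i) endo. norm (from_endo x) \<le> norm x * b"
    using bounded_linear.pos_bounded[OF bounded_linear_from_endo] by blast
  \<comment> \<open>The radius solves (exp (c a) - 1) a b = e, where a and b bound the maps
    \<open>to_endo\<close> and \<open>from_endo\<close> through which the estimate for
    \<open>exp\<close> is transported.\<close>
  define c where "c = ln (1 + e / (a * b)) / a"
  have ec: "exp (c * a) - 1 = e / (a * b)"
    using a b assms by (simp add: c_def exp_ln_iff[THEN iffD2] add_pos_pos)
  show thesis
  proof
    show "0 < c"
      using a b assms by (auto simp: c_def intro!: divide_pos_pos ln_gt_zero)
    fix X Y :: "'i cmat"
    assume "norm X \<le> c" "norm Y \<le> c"
    then have *: "norm (to_endo X) \<le> c * a" "norm (to_endo Y) \<le> c * a"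
      by (meson a less_imp_le mult_right_mono order_trans)+
    have "mexp X - mexp Y - (X - Y) = from_endo (to_endo (mexp X - mexp Y - (X - Y)))"
      by simp
    also have "norm \<dots> \<le> norm (exp (to_endo X) - exp (to_endo Y) - (to_endo X - to_endo Y)) * b"
      by (rule order_trans[OF b(2)]) (simp add: to_endo_simps)
    also have "\<dots> \<le> (e / (a * b) * norm (to_endo X - to_endo Y)) * b"
      using norm_exp_diff_le[OF *] b(1) unfolding ec by (intro mult_right_mono) auto
    also have "\<dots> \<le> (e / (a * b) * (norm (X - Y) * a)) * b"
      using a(2)[of "X - Y"] a b assms by (intro mult_right_mono mult_left_mono) (auto simp: to_endo_simps)
    also have "\<dots> = e * norm (X - Y)"
      using a b by simp
    finally show "norm (mexp X - mexp Y - (X - Y)) \<le> e * norm (X - Y)" .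
  qed
qed

lemma continuous_on_mexp_scale: "continuous_on UNIV (\<lambda>t::real. mexp (t *\<^sub>R X))"
proof -
  have "continuous_on UNIV (\<lambda>t::real. from_endo (exp (t *\<^sub>R to_endo X)))"
    by (intro bounded_linear.continuous_on[OF bounded_linear_from_endo] continuous_at_imp_continuous_on
        ballI has_vector_derivative_continuous[OF exp_scaleR_has_vector_derivative_right])
  moreover have "from_endo (exp (t *\<^sub>R to_endo X)) = mexp (t *\<^sub>R X)" for t
    by (metis from_endo_to_endo linear_cmul[OF to_endo_linear] to_endo_mexp)
  ultimately show ?thesis
    by simp
qed

text \<open>Linear maps on matrices are continuous, so agreement on powers passes through the
  exponential series. The applications are conjugation and the block diagonal part, each paired with
  the identity map.\<close>

lemma mexp_hom:
  fixes f :: "'i::finite cmat \<Rightarrow> 'b::real_normed_vector"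
  assumes f: "linear f" and g: "linear g" and pow: "\<And>k. f (((**) X ^^ k) (mat 1)) = g (((**) Y ^^ k) (mat 1))"
  shows "f (mexp X) = g (mexp Y)"
proof -
  have "(\<lambda>k. f ((1 / fact k) *\<^sub>R (((**) X ^^ k) (mat 1)))) sums f (mexp X)"
    using f[unfolded linear_conv_bounded_linear] mexp_converges by (rule bounded_linear.sums)
  moreover have "(\<lambda>k. g ((1 / fact k) *\<^sub>R (((**) Y ^^ k) (mat 1)))) sums g (mexp Y)"
    using g[unfolded linear_conv_bounded_linear] mexp_converges by (rule bounded_linear.sums)
  ultimately show ?thesis
    by (simp only: linear_cmul[OF f] linear_cmul[OF g] pow) (rule sums_unique2)
qed

section \<open>Lie algebras of closed matrix subgroups\<close>

lemma mexp_scale_tendsto_one: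
  assumes "s \<longlonglongrightarrow> (0::real)"
  shows "(\<lambda>j. mexp (s j *\<^sub>R X)) \<longlonglongrightarrow> mat 1"
proof -
  have "isCont (\<lambda>t::real. mexp (t *\<^sub>R X)) 0"
    using continuous_on_mexp_scale[of X] by (simp add: continuous_on_eq_continuous_at)
  from isCont_tendsto_compose[OF this assms] show ?thesis
    by simp
qed

lemma inverse_nat_seq: "(\<lambda>j. inverse (real (Suc j))) \<longlonglongrightarrow> 0" "0 < inverse (real (Suc j))"
  using LIMSEQ_inverse_real_of_nat by simp_all

lemma subspace_limit_mem:
  fixes V :: "'a::euclidean_space set"
  assumes "subspace V" "f \<longlonglongrightarrow> x" "\<And>j. f j \<in> V"
  shows "x \<in> V"
  using closed_sequentially[OF closed_subspace[OF assms(1)] assms(3,2)] .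

text \<open>The difference quotients at 1 stay in V because \<open>mat 1\<close> does, and V is
  closed by finite dimension. This turns a linear constraint on a group into one on its Lie
  algebra.\<close>

lemma mem_subspace_if_mexp_mem:
  assumes V: "subspace V" and "mat 1 \<in> V" and "\<And>t::real. mexp (t *\<^sub>R X) \<in> V"
  shows "X \<in> V"
  by (rule subspace_limit_mem[OF V mexp_diff_quotient[OF inverse_nat_seq]])
     (intro subspace_scale[OF V] subspace_diff[OF V] assms)

text \<open>[X, Y] is the derivative of Ad(exp tX) Y at t = 0. Writing a Y b - Y as (a - 1) Y b + Y
  (b - 1) reduces it to difference quotients of exponentials.\<close>

lemma bracket_mem_if_conj_mem:
  assumes V: "subspace V" and Y: "Y \<in> V"
    and conj: "\<And>t::real. mexp (t *\<^sub>R X) ** Y ** mexp (- (t *\<^sub>R X)) \<in> V"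
  shows "bracket X Y \<in> V"
proof -
  define s where "s j = inverse (real (Suc j))" for j
  have s: "s \<longlonglongrightarrow> 0" "\<And>j. 0 < s j"
    unfolding s_def by (fact inverse_nat_seq)+
  have "(\<lambda>j. ((mexp (s j *\<^sub>R X) - mat 1) /\<^sub>R s j) ** Y ** mexp (s j *\<^sub>R (- X))
      + Y ** ((mexp (s j *\<^sub>R (- X)) - mat 1) /\<^sub>R s j)) \<longlonglongrightarrow> X ** Y ** mat 1 + Y ** (- X)"
    by (intro tendsto_add mm.tendsto mexp_diff_quotient mexp_scale_tendsto_one tendsto_const s)
  also have "X ** Y ** mat 1 + Y ** (- X) = bracket X Y"
    by (simp add: bracket_def mm.minus_right)
  also have "(\<lambda>j. ((mexp (s j *\<^sub>R X) - mat 1) /\<^sub>R s j) ** Y ** mexp (s j *\<^sub>R (- X))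
      + Y ** ((mexp (s j *\<^sub>R (- X)) - mat 1) /\<^sub>R s j)) =
    (\<lambda>j. (mexp (s j *\<^sub>R X) ** Y ** mexp (- (s j *\<^sub>R X)) - Y) /\<^sub>R s j)"
    by (simp add: mm.scaleR_left mm.scaleR_right mm.diff_left mm.diff_right flip: scaleR_add_right)
  finally show ?thesis
    by (rule subspace_limit_mem[OF V]) (intro subspace_scale[OF V] subspace_diff[OF V] conj Y)
qed

text \<open>For b inverse to a, b - 1 = - b (a - 1). Once a is within 1/2 of 1, this bounds b by 2;
  hence b tends to 1, and dividing the same identity by s gives the limit.\<close>

lemma matrix_inv_diff_quotient:
  assumes inv: "\<And>j. invertible (g j)" and s: "s \<longlonglongrightarrow> 0" "\<And>j. (0::real) < s j"
    and lim: "(\<lambda>j. (g j - mat 1) /\<^sub>R s j) \<longlonglongrightarrow> (X :: 'i::finite cmat)"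
  shows "(\<lambda>j. (matrix_inv (g j) - mat 1) /\<^sub>R s j) \<longlonglongrightarrow> - X"
proof -
  define a where "a j = to_endo (g j)" for j
  define b where "b j = to_endo (matrix_inv (g j))" for j
  have ba: "b j * a j = 1" for j
  proof -
    have "matrix_inv (g j) ** g j = mat 1"
      using inv[of j] by (rule matrix_inv_mult)
    then show ?thesis
      by (simp add: a_def b_def flip: to_endo_mult to_endo_one)
  qed
  have q: "(\<lambda>j. (a j - 1) /\<^sub>R s j) \<longlonglongrightarrow> to_endo X"
    using lim by (subst (asm) tendsto_to_endo_iff[symmetric]) (simp add: to_endo_simps a_def)
  have "(\<lambda>j. s j *\<^sub>R ((a j - 1) /\<^sub>R s j)) \<longlonglongrightarrow> 0 *\<^sub>R to_endo X"
    by (intro tendsto_intros s q)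
  moreover have "s j *\<^sub>R ((a j - 1) /\<^sub>R s j) = a j - 1" for j
    using s(2)[of j] by simp
  ultimately have a: "(\<lambda>j. a j - 1) \<longlonglongrightarrow> 0"
    by simp
  have b_eq: "b j - 1 = - (b j * (a j - 1))" for j
    using ba[of j] by (simp add: algebra_simps)
  have "(\<lambda>j. b j - 1) \<longlonglongrightarrow> 0"
  proof (rule Lim_null_comparison)
    have "\<forall>\<^sub>F j in sequentially. norm (a j - 1) < 1 / 2"
      by (rule order_tendstoD(2)[OF tendsto_norm_zero[OF a]]) simp
    then show "\<forall>\<^sub>F j in sequentially. norm (b j - 1) \<le> 2 * norm (a j - 1)"
    proof eventually_elim
      case (elim j)
      have *: "norm (b j - 1) \<le> norm (b j) * norm (a j - 1)"
        unfolding b_eq norm_minus_cancel by (rule norm_mult_ineq)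
      also have "\<dots> \<le> norm (b j) * (1 / 2)"
        using elim by (intro mult_left_mono) auto
      finally have "norm (b j) \<le> 2"
        using norm_triangle_ineq[of 1 "b j - 1"] by simp
      then have "norm (b j) * norm (a j - 1) \<le> 2 * norm (a j - 1)"
        by (intro mult_right_mono) auto
      with * show ?case by linarith
    qed
    show "(\<lambda>j. 2 * norm (a j - 1)) \<longlonglongrightarrow> 0"
      using tendsto_mult_right_zero[OF tendsto_norm_zero[OF a]] .
  qed
  then have "b \<longlonglongrightarrow> 1"
    by (simp add: LIM_zero_cancel)
  then have "(\<lambda>j. - (b j * ((a j - 1) /\<^sub>R s j))) \<longlonglongrightarrow> - (1 * to_endo X)"
    by (intro tendsto_intros q)
  moreover have "- (b j * ((a j - 1) /\<^sub>R s j)) = (b j - 1) /\<^sub>R s j" for j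
    by (subst b_eq) simp
  ultimately show ?thesis
    by (subst tendsto_to_endo_iff[symmetric]) (simp add: to_endo_simps b_def)
qed

lemma mexp_mem_closure:
  assumes S: "mat_subgroup S" and g: "\<And>j. g j \<in> S"
    and s: "s \<longlonglongrightarrow> 0" "\<And>j. (0::real) < s j"
    and lim: "(\<lambda>j. (g j - mat 1) /\<^sub>R s j) \<longlonglongrightarrow> X" and t: "0 \<le> t"
  shows "mexp (t *\<^sub>R X) \<in> closure S"
proof -
  define h where "h j = ((**) (g j) ^^ nat \<lfloor>t / s j\<rfloor>) (mat 1)" for j
  have pow: "((**) A ^^ k) (mat 1) \<in> S" if "A \<in> S" for A k
    using S that by (induction k) (auto simp: mat_subgroup_def)
  have "(\<lambda>j. (to_endo (g j) - 1) /\<^sub>R s j) \<longlonglongrightarrow> to_endo X"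
    using lim by (subst (asm) tendsto_to_endo_iff[symmetric]) (simp add: to_endo_simps)
  from power_tendsto_exp[OF s this t] have "(\<lambda>j. to_endo (h j)) \<longlonglongrightarrow> to_endo (mexp (t *\<^sub>R X))"
    by (simp add: to_endo_simps h_def to_endo_matpow)
  then have "h \<longlonglongrightarrow> mexp (t *\<^sub>R X)"
    by (simp add: tendsto_to_endo_iff)
  then show ?thesis
    unfolding closure_sequential using pow g h_def by metis
qed

lemma lie_algebra_of_memI: "(\<And>t. mexp (t *\<^sub>R X) \<in> S) \<Longrightarrow> X \<in> lie_algebra_of S"
  by (simp add: lie_algebra_of_def)

lemma mexp_scale_mem: "X \<in> lie_algebra_of S \<Longrightarrow> mexp (t *\<^sub>R X) \<in> S"
  by (simp add: lie_algebra_of_def)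

lemma lie_algebra_of_scale: "X \<in> lie_algebra_of S \<Longrightarrow> t *\<^sub>R X \<in> lie_algebra_of S"
  by (simp add: lie_algebra_of_def)

lemma mexp_conj:
  fixes g :: "'i::finite cmat"
  assumes "invertible g"
  shows "mexp (g ** X ** matrix_inv g) = g ** mexp X ** matrix_inv g"
proof -
  note inv = matrix_inv_mult(2)[OF assms] and inv' = matrix_inv_mult(1)[OF assms]
  have "((**) (g ** X ** matrix_inv g) ^^ k) (mat 1) = g ** ((**) X ^^ k) (mat 1) ** matrix_inv g" for k
  proof (induction k)
    case (Suc k)
    then show ?case
      by (simp add: matrix_mul_assoc[symmetric])
         (metis inv matrix_mul_assoc matrix_mul_lid)
  qed (simp add: inv')
  moreover have "linear (\<lambda>Y. g ** Y ** matrix_inv g)"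
    by (rule linearI) (simp_all add: mm.add_left mm.add_right mm.scaleR_left mm.scaleR_right)
  ultimately show ?thesis
    using mexp_hom[of "\<lambda>Y. Y" "\<lambda>Y. g ** Y ** matrix_inv g"] linear_id[unfolded id_def] by metis
qed

text \<open>Closedness is demanded only of one-parameter groups: a group that is relatively closed
  in a set containing the relevant exponentials satisfies this without being closed among all
  matrices.\<close>

locale lie_closed_subgroup =
  fixes S :: "'i::finite cmat set"
  assumes subgroup: "mat_subgroup S"
    and closure: "lie_algebra_of (closure S) \<subseteq> lie_algebra_of S"
begin

lemma one_mem: "mat 1 \<in> S" and mult_mem: "x \<in> S \<Longrightarrow> y \<in> S \<Longrightarrow> x ** y \<in> S"
  and inv_mem: "x \<in> S \<Longrightarrow> matrix_inv x \<in> S" and invertible: "x \<in> S \<Longrightarrow> invertible x"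
  using subgroup by (auto simp: mat_subgroup_def)

text \<open>Positive times are limits of powers of g j, negative times limits of powers of the
  inverses, whose direction is - X. The closure assumption brings the resulting one-parameter group
  back into S.\<close>

lemma limit_direction_mem:
  assumes g: "\<And>j. g j \<in> S" and s: "s \<longlonglongrightarrow> 0" "\<And>j. (0::real) < s j"
    and lim: "(\<lambda>j. (g j - mat 1) /\<^sub>R s j) \<longlonglongrightarrow> X"
  shows "X \<in> lie_algebra_of S"
proof (rule subsetD[OF closure], rule lie_algebra_of_memI)
  fix t
  show "mexp (t *\<^sub>R X) \<in> closure S"
  proof (cases "0 \<le> t")
    case True
    then show ?thesis
      using mexp_mem_closure[OF subgroup g s lim] by blast
  next
    case False
    have "(\<lambda>j. (matrix_inv (g j) - mat 1) /\<^sub>R s j) \<longlonglongrightarrow> - X"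
      by (intro matrix_inv_diff_quotient s lim invertible g)
    from mexp_mem_closure[OF subgroup inv_mem[OF g] s this, of "- t"] False show ?thesis
      by simp
  qed
qed

text \<open>The product of exp (sX) and exp (sY) need not be a one-parameter group, but its
  direction at s = 0 is X + Y, and limits of directions suffice.\<close>

lemma subspace_lie: "subspace (lie_algebra_of S)"
proof (rule subspaceI)
  show "0 \<in> lie_algebra_of S"
    using one_mem by (simp add: lie_algebra_of_def)
  fix X Y
  assume X: "X \<in> lie_algebra_of S" and Y: "Y \<in> lie_algebra_of S"
  define s where "s j = inverse (real (Suc j))" for j
  have s: "s \<longlonglongrightarrow> 0" "\<And>j. 0 < s j"
    unfolding s_def by (fact inverse_nat_seq)+
  have "(\<lambda>j. ((mexp (s j *\<^sub>R X) - mat 1) /\<^sub>R s j) ** mexp (s j *\<^sub>R Y)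
      + ((mexp (s j *\<^sub>R Y) - mat 1) /\<^sub>R s j)) \<longlonglongrightarrow> X ** mat 1 + Y"
    by (intro tendsto_add mm.tendsto mexp_diff_quotient mexp_scale_tendsto_one s)
  also have "X ** mat 1 + Y = X + Y"
    by simp
  also have "(\<lambda>j. ((mexp (s j *\<^sub>R X) - mat 1) /\<^sub>R s j) ** mexp (s j *\<^sub>R Y)
      + ((mexp (s j *\<^sub>R Y) - mat 1) /\<^sub>R s j))
    = (\<lambda>j. (mexp (s j *\<^sub>R X) ** mexp (s j *\<^sub>R Y) - mat 1) /\<^sub>R s j)"
    by (simp add: mm.scaleR_left mm.diff_left flip: scaleR_add_right)
  finally show "X + Y \<in> lie_algebra_of S"
    using limit_direction_mem[OF mult_mem[OF mexp_scale_mem[OF X] mexp_scale_mem[OF Y]] s] by blast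
qed (rule lie_algebra_of_scale)

lemma conj_lie_mem:
  assumes "g \<in> S" "Y \<in> lie_algebra_of S"
  shows "g ** Y ** matrix_inv g \<in> lie_algebra_of S"
proof (rule lie_algebra_of_memI)
  fix t
  have "t *\<^sub>R (g ** Y ** matrix_inv g) = g ** (t *\<^sub>R Y) ** matrix_inv g"
    by (simp add: mm.scaleR_left mm.scaleR_right)
  then show "mexp (t *\<^sub>R (g ** Y ** matrix_inv g)) \<in> S"
    using assms by (simp add: mexp_conj invertible mult_mem inv_mem mexp_scale_mem)
qed

lemma bracket_lie_mem:
  assumes "X \<in> lie_algebra_of S" "Y \<in> lie_algebra_of S"
  shows "bracket X Y \<in> lie_algebra_of S"
  using conj_lie_mem[OF mexp_scale_mem[OF assms(1)] assms(2)]
  by (intro bracket_mem_if_conj_mem[OF subspace_lie assms(2)]) simp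

text \<open>A group element g near 1 outside the image of the exponential would have a nearest
  \<open>mexp X\<close> with X in a small ball of the Lie algebra; the direction from \<open>mexp X\<close> to g
  subconverges to a unit vector of the Lie algebra, along which X can be improved.\<close>

lemma near_one_in_mexp_image:
  obtains e where "0 < e" and "\<And>g. g \<in> S \<Longrightarrow> norm (g - mat 1) < e \<Longrightarrow> g \<in> mexp ` lie_algebra_of S"
proof (rule ccontr)
  let ?L = "lie_algebra_of S"
  assume "\<not> thesis"
  then have "\<exists>g. g \<in> S \<and> norm (g - mat 1) < inverse (real (Suc n)) \<and> g \<notin> mexp ` ?L" for n
    using that[of "inverse (real (Suc n))"] by auto
  then obtain g where g: "\<And>n. g n \<in> S" "\<And>n. norm (g n - mat 1) < inverse (real (Suc n))"
      "\<And>n. g n \<notin> mexp ` ?L"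
    by metis
  \<comment> \<open>The constant 1/2 makes the exponential bi-Lipschitz near 0, which forces the
    nearest points X n to tend to 0. The constant 1/4 is for the final comparison, where two errors
    of 1/4 of the distance beat the minimum.\<close>
  have half: "0 < (1/2 :: real)" and quarter: "0 < (1/4 :: real)" by simp_all
  obtain r where r: "0 < r" "\<And>X Y :: 'i cmat. norm X \<le> r \<Longrightarrow> norm Y \<le> r \<Longrightarrow>
      norm (mexp X - mexp Y - (X - Y)) \<le> (1/2) * norm (X - Y)"
    using mexp_strict_differentiable[OF half] by metis
  obtain r' where r': "0 < r'" "\<And>X Y :: 'i cmat. norm X \<le> r' \<Longrightarrow> norm Y \<le> r' \<Longrightarrow>
      norm (mexp X - mexp Y - (X - Y)) \<le> (1/4) * norm (X - Y)"
    using mexp_strict_differentiable[OF quarter] by metis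
  have lip: "norm (mexp X - mexp Y) \<le> 2 * norm (X - Y)" "norm (X - Y) \<le> 2 * norm (mexp X - mexp Y)"
    if "norm X \<le> r" "norm Y \<le> r" for X Y :: "'i cmat"
    using r(2)[OF that] norm_triangle_ineq2[of "mexp X - mexp Y" "X - Y"]
      norm_triangle_ineq2[of "X - Y" "mexp X - mexp Y"] norm_minus_commute[of "X - Y" "mexp X - mexp Y"]
    by simp_all
  define K where "K = ?L \<inter> cball 0 r"
  have "compact K"
    unfolding K_def by (intro closed_Int_compact closed_subspace subspace_lie compact_cball)
  have zero: "0 \<in> K"
    using r(1) subspace_0[OF subspace_lie] by (simp add: K_def)
  have "continuous_on K mexp"
  proof (rule continuous_on_iff[THEN iffD2], intro ballI allI impI)
    fix X e assume "X \<in> K" "0 < (e::real)"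
    then show "\<exists>d>0. \<forall>Y\<in>K. dist Y X < d \<longrightarrow> dist (mexp Y) (mexp X) < e"
      using lip(1) by (intro exI[of _ "e/2"]) (fastforce simp: K_def dist_norm)
  qed
  then have "\<exists>X\<in>K. \<forall>Y\<in>K. norm (g n - mexp X) \<le> norm (g n - mexp Y)" for n
    using zero by (intro continuous_attains_inf \<open>compact K\<close> continuous_intros) auto
  then obtain X where X: "\<And>n. X n \<in> K"
      and min: "\<And>n Y. Y \<in> K \<Longrightarrow> norm (g n - mexp (X n)) \<le> norm (g n - mexp Y)"
    by metis
  define d where "d n = g n - mexp (X n)" for n
  have d_nz: "d n \<noteq> 0" for n
    using g(3)[of n] X[of n] by (auto simp: d_def K_def)
  have d_le: "norm (d n) \<le> norm (g n - mat 1)" for n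
    using min[OF zero, of n] by (simp add: d_def)
  have g_lim: "(\<lambda>n. norm (g n - mat 1)) \<longlonglongrightarrow> 0"
    by (rule Lim_null_comparison[OF _ inverse_nat_seq(1)])
       (use g(2) less_imp_le in \<open>auto intro!: always_eventually\<close>)
  have d_lim: "(\<lambda>n. norm (d n)) \<longlonglongrightarrow> 0"
    by (rule Lim_null_comparison[OF _ g_lim]) (use d_le in auto)
  have X_lim: "X \<longlonglongrightarrow> 0"
  proof (rule Lim_null_comparison)
    have "norm (X n) \<le> 4 * norm (g n - mat 1)" for n
    proof -
      have "norm (X n) \<le> 2 * norm (mexp (X n) - mat 1)"
        using lip(2)[of "X n" 0] X[of n] r(1) by (simp add: K_def)
      also have "norm (mexp (X n) - mat 1) \<le> norm (g n - mat 1) + norm (d n)"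
        using norm_triangle_ineq4[of "g n - mat 1" "d n"] by (simp add: d_def)
      finally show ?thesis
        using d_le[of n] by simp
    qed
    then show "\<forall>\<^sub>F n in sequentially. norm (X n) \<le> 4 * norm (g n - mat 1)"
      by simp
    show "(\<lambda>n. 4 * norm (g n - mat 1)) \<longlonglongrightarrow> 0"
      using tendsto_mult_right_zero[OF g_lim] .
  qed
  define u where "u n = d n /\<^sub>R norm (d n)" for n
  have "u n \<in> sphere 0 1" for n
    using d_nz by (simp add: u_def)
  then obtain U k where U: "U \<in> sphere 0 1" and k: "strict_mono k" and u_lim: "(u \<circ> k) \<longlonglongrightarrow> U"
    using compact_sphere[unfolded compact_def] by metis
  have d_k: "(\<lambda>n. norm (d (k n))) \<longlonglongrightarrow> 0" and X_k: "(\<lambda>n. X (k n)) \<longlonglongrightarrow> 0"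
    using LIMSEQ_subseq_LIMSEQ[OF d_lim k] LIMSEQ_subseq_LIMSEQ[OF X_lim k] by (simp_all add: o_def)
  have u_k: "(\<lambda>n. u (k n)) \<longlonglongrightarrow> U"
    using u_lim by (simp add: o_def)
  have "(\<lambda>n. mexp (- X (k n)) - mat 1) \<longlonglongrightarrow> 0"
  proof (rule Lim_null_comparison)
    show "\<forall>\<^sub>F n in sequentially. norm (mexp (- X (k n)) - mat 1) \<le> 2 * norm (X (k n))"
      using lip(1)[of "- X (k n)" 0 for n] X r(1) by (auto simp: K_def)
    show "(\<lambda>n. 2 * norm (X (k n))) \<longlonglongrightarrow> 0"
      using tendsto_mult_right_zero[OF tendsto_norm_zero[OF X_k]] .
  qed
  then have "(\<lambda>n. mexp (- X (k n))) \<longlonglongrightarrow> mat 1"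
    by (rule LIM_zero_cancel)
  then have "(\<lambda>n. mexp (- X (k n)) ** u (k n)) \<longlonglongrightarrow> mat 1 ** U"
    by (intro mm.tendsto u_k)
  moreover have "mexp (- X (k n)) ** u (k n) = (mexp (- X (k n)) ** g (k n) - mat 1) /\<^sub>R norm (d (k n))" for n
    by (simp add: u_def d_def mm.scaleR_right mm.diff_right)
  ultimately have "(\<lambda>n. (mexp (- X (k n)) ** g (k n) - mat 1) /\<^sub>R norm (d (k n))) \<longlonglongrightarrow> U"
    by simp
  moreover have "mexp (- X n) \<in> S" for n
    using X[of n] mexp_scale_mem[of "X n" S "-1"] by (simp add: K_def)
  ultimately have UL: "U \<in> ?L"
    using d_nz by (intro limit_direction_mem[where g = "\<lambda>n. mexp (- X (k n)) ** g (k n)", OF _ d_k])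
       (auto intro: mult_mem g)
  \<comment> \<open>X and the step of length norm d along U are both eventually shorter than m, so
    the improved point stays in the balls of radius r and r' and competes in the minimum.\<close>
  define m where "m = min r r' / 2"
  have m: "0 < m" "2 * m \<le> r" "2 * m \<le> r'"
    using r(1) r'(1) by (auto simp: m_def)
  have "\<forall>\<^sub>F n in sequentially. norm (X (k n)) < m"
    using X_k m(1) by (auto simp: tendsto_iff)
  moreover have "\<forall>\<^sub>F n in sequentially. norm (d (k n)) < m"
    using d_k m(1) by (auto simp: tendsto_iff)
  moreover have "\<forall>\<^sub>F n in sequentially. norm (u (k n) - U) < 1/4"
    using tendstoD[OF u_k, of "1/4"] by (simp add: dist_norm)
  ultimately have "\<forall>\<^sub>F n in sequentially. False"
  proof eventually_elim
    fix n
    assume Xn: "norm (X (k n)) < m" and dn: "norm (d (k n)) < m" and un: "norm (u (k n) - U) < 1/4"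
    define Z where "Z = X (k n) + norm (d (k n)) *\<^sub>R U"
    have ZX: "Z - X (k n) = norm (d (k n)) *\<^sub>R U"
      by (simp add: Z_def)
    have "norm Z \<le> 2 * m"
      unfolding Z_def using U Xn dn by (intro norm_triangle_le) simp
    moreover have "Z \<in> ?L"
      unfolding Z_def using X[of "k n"] UL
      by (intro subspace_add subspace_scale subspace_lie) (auto simp: K_def)
    ultimately have "Z \<in> K"
      using m by (simp add: K_def)
    have est: "norm (mexp Z - mexp (X (k n)) - (Z - X (k n))) \<le> (1/4) * norm (Z - X (k n))"
      using \<open>norm Z \<le> 2 * m\<close> Xn m by (intro r'(2)) auto
    have "g (k n) - mexp Z = (d (k n) - norm (d (k n)) *\<^sub>R U) - (mexp Z - mexp (X (k n)) - (Z - X (k n)))"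
      by (simp add: d_def Z_def)
    also have "d (k n) - norm (d (k n)) *\<^sub>R U = norm (d (k n)) *\<^sub>R (u (k n) - U)"
      using d_nz by (simp add: u_def scaleR_diff_right)
    finally have eq: "g (k n) - mexp Z =
        norm (d (k n)) *\<^sub>R (u (k n) - U) - (mexp Z - mexp (X (k n)) - (Z - X (k n)))" .
    have "norm (g (k n) - mexp Z) \<le> norm (norm (d (k n)) *\<^sub>R (u (k n) - U))
        + norm (mexp Z - mexp (X (k n)) - (Z - X (k n)))"
      unfolding eq by (rule norm_triangle_ineq4)
    also have "\<dots> \<le> norm (d (k n)) * norm (u (k n) - U) + (1/4) * norm (Z - X (k n))"
      using est by (intro add_mono) auto
    also have "\<dots> \<le> norm (d (k n)) * (1/4) + (1/4) * norm (d (k n))"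
      using un U by (intro add_mono mult_left_mono) (auto simp: ZX)
    also have "\<dots> < norm (d (k n))"
      using d_nz[of "k n"] by simp
    finally show False
      using min[OF \<open>Z \<in> K\<close>, of "k n"] by (simp add: d_def)
  qed
  then show False
    by simp
qed

end

section \<open>The block structure of su(n,1)\<close>

lemma mexp_has_vector_derivative_0:
  "((\<lambda>t. mexp (t *\<^sub>R X)) has_vector_derivative X) (at 0)"
proof -
  have eq: "mexp (t *\<^sub>R X) = from_endo (exp (t *\<^sub>R to_endo X))" for t
    by (metis from_endo_to_endo linear_cmul[OF to_endo_linear] to_endo_mexp)
  have "((\<lambda>t. from_endo (exp (t *\<^sub>R to_endo X))) has_vector_derivative
      from_endo (exp (0 *\<^sub>R to_endo X) * to_endo X)) (at 0)"
    by (intro bounded_linear.has_vector_derivative[OF bounded_linear_from_endo]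
        exp_scaleR_has_vector_derivative_right)
  then show ?thesis
    by (simp add: eq)
qed

lemma mexp_entry_has_vector_derivative_0:
  "((\<lambda>t. mexp (t *\<^sub>R X) $ i $ j) has_vector_derivative X $ i $ j) (at 0)"
  by (intro bounded_linear.has_vector_derivative[OF bounded_linear_vec_nth] mexp_has_vector_derivative_0)

text \<open>A permutation other than the identity moves some k and also the image of k, so deleting
  one factor still leaves a zero entry of \<open>mat 1\<close> in the product.\<close>

lemma prod_permutes_derivative_at_identity:
  fixes X :: "'i::finite cmat"
  assumes "\<sigma> permutes UNIV"
  shows "(\<Sum>i\<in>UNIV. X $ i $ \<sigma> i * (\<Prod>j\<in>UNIV - {i}. (mat 1 :: 'i cmat) $ j $ \<sigma> j))
       = (if \<sigma> = id then trace X else 0)"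
proof (cases "\<sigma> = id")
  case True
  then show ?thesis
    by (simp add: mat_def trace_def)
next
  case False
  have z: "(\<Prod>j\<in>UNIV - {i}. (mat 1 :: 'i cmat) $ j $ \<sigma> j) = 0" for i
  proof -
    obtain k where k: "\<sigma> k \<noteq> k"
      using False by (auto simp: fun_eq_iff)
    then have "\<sigma> (\<sigma> k) \<noteq> \<sigma> k"
      using permutes_inj[OF assms] by (simp add: inj_eq)
    then have "\<exists>j\<in>UNIV - {i}. (mat 1 :: 'i cmat) $ j $ \<sigma> j = 0"
      using k by (cases "i = k") (auto simp: mat_def intro: bexI[of _ k] bexI[of _ "\<sigma> k"])
    then show ?thesis
      by (intro prod_zero) auto
  qed
  show ?thesis
    unfolding z using False by simp
qed

lemma det_mexp_has_vector_derivative_0: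
  fixes X :: "'i::finite cmat"
  shows "((\<lambda>t. det (mexp (t *\<^sub>R X))) has_vector_derivative trace X) (at 0)"
proof -
  let ?P = "{\<sigma> :: 'i \<Rightarrow> 'i. \<sigma> permutes UNIV}"
  have D: "((\<lambda>t. \<Prod>i\<in>UNIV. mexp (t *\<^sub>R X) $ i $ \<sigma> i) has_vector_derivative
      (if \<sigma> = id then trace X else 0)) (at 0)" if "\<sigma> \<in> ?P" for \<sigma>
  proof -
    have "((\<lambda>t. \<Prod>i\<in>UNIV. mexp (t *\<^sub>R X) $ i $ \<sigma> i) has_derivative
        (\<lambda>y. \<Sum>i\<in>UNIV. (y *\<^sub>R X $ i $ \<sigma> i) *
          (\<Prod>j\<in>UNIV - {i}. mexp ((0::real) *\<^sub>R X) $ j $ \<sigma> j))) (at 0)"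
      by (rule has_derivative_prod)
         (rule mexp_entry_has_vector_derivative_0[unfolded has_vector_derivative_def])
    moreover have "(\<Sum>i\<in>UNIV. (y *\<^sub>R X $ i $ \<sigma> i) *
          (\<Prod>j\<in>UNIV - {i}. mexp ((0::real) *\<^sub>R X) $ j $ \<sigma> j))
        = y *\<^sub>R (if \<sigma> = id then trace X else 0)" for y
      using prod_permutes_derivative_at_identity[of \<sigma> X] that
      by (simp flip: scaleR_sum_right add: mult_scaleR_left)
    ultimately show ?thesis
      by (simp add: has_vector_derivative_def)
  qed
  have "((\<lambda>t. \<Sum>\<sigma>\<in>?P. of_int (sign \<sigma>) * (\<Prod>i\<in>UNIV. mexp (t *\<^sub>R X) $ i $ \<sigma> i)) has_vector_derivative
      (\<Sum>\<sigma>\<in>?P. of_int (sign \<sigma>) * (if \<sigma> = id then trace X else 0))) (at 0)"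
    by (intro has_vector_derivative_sum has_vector_derivative_mult_right D)
  also have "(\<Sum>\<sigma>\<in>?P. of_int (sign \<sigma>) * (if \<sigma> = id then trace X else 0))
      = (\<Sum>\<sigma>\<in>?P. if \<sigma> = id then trace X else 0)"
    by (intro sum.cong) (auto simp: sign_id)
  also have "\<dots> = trace X"
    by (simp add: finite_permutations permutes_id)
  finally show ?thesis
    by (simp add: det_def)
qed

lemma mexp_mem_subalgebra:
  assumes V: "subspace V" "mat 1 \<in> V" "\<And>X Y. X \<in> V \<Longrightarrow> Y \<in> V \<Longrightarrow> X ** Y \<in> V" and X: "X \<in> V"
  shows "mexp X \<in> V"
proof -
  have "((**) X ^^ k) (mat 1) \<in> V" for k
    by (induction k) (auto intro: V X)
  then show ?thesis
    by (intro subspace_limit_mem[OF V(1) mexp_converges[unfolded sums_def]] subspace_sum subspace_scale V)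
qed

section \<open>Block triangular matrices graded by \<open>level\<close>\<close>

locale block_indices =
  fixes p q :: "'i::finite"
  assumes pq: "p \<noteq> q"
begin

text \<open>Ordering the indices as p, first block, q makes \<open>n_alg\<close> strictly upper triangular.\<close>

definition level :: "'i \<Rightarrow> nat" where
  "level i = (if i = p then 0 else if i = q then 2 else 1)"

text \<open>The Gram matrix of \<open>hform\<close> is the permutation matrix of \<open>flip\<close>, so the matrices that are skew
  for \<open>hform\<close> form \<open>u_alg\<close> below.\<close>

definition flip :: "'i \<Rightarrow> 'i" where
  "flip i = (if i = p then q else if i = q then p else i)"

definition upper :: "'i cmat set" where
  "upper = {X. \<forall>i j. level j < level i \<longrightarrow> X $ i $ j = 0}"

definition strict_upper :: "'i cmat set" where
  "strict_upper = {X. \<forall>i j. level j \<le> level i \<longrightarrow> X $ i $ j = 0}"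

definition block_diag :: "'i cmat set" where
  "block_diag = {X. \<forall>i j. level i \<noteq> level j \<longrightarrow> X $ i $ j = 0}"

text \<open>A linear stand-in for S(U(n-1)U(1)): closed under products and limits, it contains that
  group, while a non-trivial element of A has distinct entries at p and q.\<close>

definition eq_block_diag :: "'i cmat set" where
  "eq_block_diag = {X \<in> block_diag. X $ p $ p = X $ q $ q}"

definition u_alg :: "'i cmat set" where
  "u_alg = {X. \<forall>i j. X $ flip i $ j = - cnj (X $ flip j $ i)}"

text \<open>On \<open>upper\<close> this is an algebra homomorphism that vanishes on
  \<open>strict_upper\<close>; on G it becomes the projection to F along N.\<close>

definition diag_part :: "'i cmat \<Rightarrow> 'i cmat" where
  "diag_part X = (\<chi> i j. if level i = level j then X $ i $ j else 0)"

lemma level_simps [simp]: "level p = 0" "level q = 2"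
  using pq by (simp_all add: level_def)

lemma level_eq_0 [simp]: "level i = 0 \<longleftrightarrow> i = p" and level_eq_2 [simp]: "level i = 2 \<longleftrightarrow> i = q"
  and level_le_2: "level i \<le> 2"
  using pq by (auto simp: level_def)

lemma flip_simps [simp]: "flip p = q" "flip q = p" "flip (flip i) = i"
  using pq by (simp_all add: flip_def)

lemma level_flip: "level (flip i) = 2 - level i"
  using pq by (simp add: level_def flip_def)

lemma bij_flip: "bij flip"
  by (rule o_bij[of flip]) (auto simp: fun_eq_iff)

lemma subspace_upper: "subspace upper" and subspace_strict_upper: "subspace strict_upper"
  and subspace_block_diag: "subspace block_diag" and subspace_eq_block_diag: "subspace eq_block_diag"
  by (auto simp: subspace_def upper_def strict_upper_def block_diag_def eq_block_diag_def)

lemma u_algI: "(\<And>i j. X $ flip i $ j = - cnj (X $ flip j $ i)) \<Longrightarrow> X \<in> u_alg"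
  and u_algD: "X \<in> u_alg \<Longrightarrow> X $ flip i $ j = - cnj (X $ flip j $ i)"
  unfolding u_alg_def by blast+

lemma subspace_u_alg: "subspace u_alg"
proof (intro subspaceI u_algI)
  fix X Y :: "'i cmat" and c :: real and i j
  assume X: "X \<in> u_alg"
  show "(c *\<^sub>R X) $ flip i $ j = - cnj ((c *\<^sub>R X) $ flip j $ i)"
    using u_algD[OF X, of i j] by simp
  assume Y: "Y \<in> u_alg"
  show "(X + Y) $ flip i $ j = - cnj ((X + Y) $ flip j $ i)"
    using u_algD[OF X, of i j] u_algD[OF Y, of i j] by simp
qed simp

lemma block_diag_subset_upper: "block_diag \<subseteq> upper"
  and strict_upper_subset_upper: "strict_upper \<subseteq> upper"
  and eq_block_diag_subset: "eq_block_diag \<subseteq> block_diag"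
  by (fastforce simp: upper_def strict_upper_def block_diag_def eq_block_diag_def)+

lemma one_mem_block_diag: "mat 1 \<in> block_diag" and one_mem_eq_block_diag: "mat 1 \<in> eq_block_diag"
  by (auto simp: block_diag_def eq_block_diag_def mat_def)

lemma mult_entry: "(X ** Y) $ i $ j = (\<Sum>k\<in>UNIV. X $ i $ k * Y $ k $ j)" for X Y :: "'i cmat"
  by (simp add: matrix_matrix_mult_def)

lemma mult_upper: "X \<in> upper \<Longrightarrow> Y \<in> upper \<Longrightarrow> X ** Y \<in> upper"
  unfolding upper_def mem_Collect_eq mult_entry
  by (intro allI impI sum.neutral ballI) (metis linorder_not_less mult_eq_0_iff order.strict_trans1)

lemma mult_block_diag: "X \<in> block_diag \<Longrightarrow> Y \<in> block_diag \<Longrightarrow> X ** Y \<in> block_diag"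
  unfolding block_diag_def mem_Collect_eq mult_entry
  by (intro allI impI sum.neutral ballI) (metis mult_eq_0_iff)

lemma mult_strict_upper_left: "X \<in> upper \<Longrightarrow> Y \<in> strict_upper \<Longrightarrow> X ** Y \<in> strict_upper"
  and mult_strict_upper_right: "X \<in> strict_upper \<Longrightarrow> Y \<in> upper \<Longrightarrow> X ** Y \<in> strict_upper"
  unfolding upper_def strict_upper_def mem_Collect_eq mult_entry
  by (intro allI impI sum.neutral ballI, metis linorder_not_less mult_eq_0_iff order_trans less_imp_le)+

lemma mult_pp: "X \<in> block_diag \<Longrightarrow> (X ** Y) $ p $ p = X $ p $ p * Y $ p $ p"
  and mult_qq: "X \<in> block_diag \<Longrightarrow> (X ** Y) $ q $ q = X $ q $ q * Y $ q $ q"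
proof -
  assume X: "X \<in> block_diag"
  have eq: "X $ p $ k * Y $ k $ p = (if k = p then X $ p $ p * Y $ p $ p else 0)"
    "X $ q $ k * Y $ k $ q = (if k = q then X $ q $ q * Y $ q $ q else 0)" for k
    using X level_eq_0[of k] level_eq_2[of k] by (auto simp: block_diag_def simp del: level_eq_0 level_eq_2)
  have "(X ** Y) $ p $ p = (\<Sum>k\<in>UNIV. if k = p then X $ p $ p * Y $ p $ p else 0)"
    "(X ** Y) $ q $ q = (\<Sum>k\<in>UNIV. if k = q then X $ q $ q * Y $ q $ q else 0)"
    unfolding mult_entry by (rule sum.cong[OF refl eq(1)], rule sum.cong[OF refl eq(2)])
  then show "(X ** Y) $ p $ p = X $ p $ p * Y $ p $ p" "(X ** Y) $ q $ q = X $ q $ q * Y $ q $ q"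
    by simp_all
qed

lemma mult_eq_block_diag: "X \<in> eq_block_diag \<Longrightarrow> Y \<in> eq_block_diag \<Longrightarrow> X ** Y \<in> eq_block_diag"
  by (auto simp: eq_block_diag_def mult_block_diag mult_pp mult_qq)

lemma linear_diag_part: "linear diag_part"
  by (rule linearI) (auto simp: diag_part_def vec_eq_iff)

lemma diag_part_block_diag: "X \<in> block_diag \<Longrightarrow> diag_part X = X"
  by (auto simp: diag_part_def block_diag_def vec_eq_iff)

lemma diag_part_strict_upper: "X \<in> strict_upper \<Longrightarrow> diag_part X = 0"
  by (auto simp: diag_part_def strict_upper_def vec_eq_iff)

lemma minus_diag_part_mem: "X \<in> upper \<Longrightarrow> X - diag_part X \<in> strict_upper"
  by (auto simp: diag_part_def strict_upper_def upper_def vec_eq_iff le_less)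

lemma diag_part_mult:
  assumes "X \<in> upper" "Y \<in> upper"
  shows "diag_part (X ** Y) = diag_part X ** diag_part Y"
proof -
  \<comment> \<open>A non-zero contribution through k needs level i \<le> level k \<le> level j, so
    when the outer levels agree the middle index lies in the same block.\<close>
  have "(if level i = level k then X $ i $ k else 0) * (if level k = level j then Y $ k $ j else 0)
      = (if level i = level j then X $ i $ k * Y $ k $ j else 0)" for i j k
    using assms by (cases "level i" "level k" rule: linorder_cases) (auto simp: upper_def)
  then have "(diag_part X ** diag_part Y) $ i $ j = diag_part (X ** Y) $ i $ j" for i j
    unfolding mult_entry diag_part_def by (simp add: mult_entry)
  then show ?thesis
    by (simp add: vec_eq_iff)
qed

lemma diag_part_mexp:
  assumes X: "X \<in> upper"
  shows "diag_part (mexp X) = mexp (diag_part X)"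
proof (rule mexp_hom[where g = "\<lambda>Y. Y", OF linear_diag_part linear_id[unfolded id_def]])
  have one: "mat 1 \<in> upper"
    using one_mem_block_diag block_diag_subset_upper by blast
  have pow: "((**) X ^^ k) (mat 1) \<in> upper" for k
    by (induction k) (auto intro: one mult_upper X)
  show "diag_part (((**) X ^^ k) (mat 1)) = ((**) (diag_part X) ^^ k) (mat 1)" for k
    by (induction k) (simp_all add: diag_part_block_diag one_mem_block_diag diag_part_mult X pow)
qed

lemma diag_part_u_alg: "X \<in> u_alg \<Longrightarrow> diag_part X \<in> u_alg"
proof -
  \<comment> \<open>Both sides say that the two levels add up to 2; \<open>level_le_2\<close> guards
    against the truncated subtraction in \<open>level_flip\<close>.\<close>
  have "level (flip i) = level j \<longleftrightarrow> level (flip j) = level i" for i j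
    using level_le_2[of i] level_le_2[of j] unfolding level_flip by linarith
  then have "diag_part X $ flip i $ j = - cnj (diag_part X $ flip j $ i)" if "X \<in> u_alg" for i j
    using u_algD[OF that, of i j] by (simp add: diag_part_def)
  then show "X \<in> u_alg \<Longrightarrow> diag_part X \<in> u_alg"
    by (blast intro: u_algI)
qed

text \<open>The auxiliary identity says that the \<open>hform\<close>-adjoint of YX is XY, the two
  signs cancelling. Taking adjoints passes through the Gram matrix, hence the reindexing of the
  middle index by \<open>flip\<close>.\<close>

lemma bracket_u_alg:
  assumes X: "X \<in> u_alg" and Y: "Y \<in> u_alg"
  shows "bracket X Y \<in> u_alg"
proof -
  have *: "(X ** Y) $ flip i $ j = cnj ((Y ** X) $ flip j $ i)" if "X \<in> u_alg" "Y \<in> u_alg" for X Y i j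
  proof -
    have "X $ flip i $ flip k * Y $ flip k $ j = cnj (Y $ flip j $ k * X $ k $ i)" for k
      using u_algD[OF that(1), of i "flip k"] u_algD[OF that(2), of k j] by (simp add: mult.commute)
    then show ?thesis
      unfolding mult_entry cnj_sum by (subst sum.reindex_bij_betw[OF bij_flip, symmetric]) simp
  qed
  show ?thesis
  proof (rule u_algI)
    show "bracket X Y $ flip i $ j = - cnj (bracket X Y $ flip j $ i)" for i j
      unfolding bracket_def vector_minus_component *[OF X Y, of i j] *[OF Y X, of i j] by simp
  qed
qed

lemma trace_bracket: "trace (bracket X Y) = 0" for X Y :: "'i cmat"
  unfolding bracket_def trace_sub using trace_mul_sym[of X Y] by simp

section \<open>The standard subalgebras as intersections of linear conditions\<close>

lemma n_alg_eq: "n_alg p q = strict_upper \<inter> u_alg"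
proof (intro subset_antisym subsetI IntI)
  fix Z
  assume "Z \<in> n_alg p q"
  then obtain v t where Z: "Z = n1_mat p q v + t *\<^sub>R N2 p q"
    by (auto simp: n_alg_def n1_alg_def n2_alg_def)
  show "Z \<in> strict_upper"
    using pq by (auto simp: Z strict_upper_def n1_mat_def N2_def level_def)
  show "Z \<in> u_alg"
    using pq by (intro u_algI) (auto simp: Z n1_mat_def N2_def flip_def)
next
  fix Z
  assume "Z \<in> strict_upper \<inter> u_alg"
  then have Z: "\<And>i j. level j \<le> level i \<Longrightarrow> Z $ i $ j = 0" "\<And>i j. Z $ flip i $ j = - cnj (Z $ flip j $ i)"
    by (simp add: strict_upper_def) (use u_algD \<open>Z \<in> _\<close> in blast)
  have "Re (Z $ p $ q) = 0"
    using Z(2)[of q q] by (simp add: complex_eq_iff)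
  then have pq': "Z $ p $ q = \<i> * of_real (Im (Z $ p $ q))"
    by (simp add: complex_eq_iff)
  have pj: "Z $ p $ j = - cnj (Z $ j $ q)" if "j \<notin> {p, q}" for j
  proof -
    have "flip j = j"
      using that by (simp add: flip_def)
    then show ?thesis
      using Z(2)[of q j] by simp
  qed
  \<comment> \<open>Column q supplies v, skewness then determines row p, and the corner entry,
    forced to be imaginary, supplies the coefficient of \<open>N2 p q\<close>.\<close>
  have "Z = n1_mat p q (\<chi> i. Z $ i $ q) + Im (Z $ p $ q) *\<^sub>R N2 p q"
    unfolding vec_eq_iff
  proof (intro allI)
    fix i j
    consider "level j \<le> level i" | "i = p" "j = q" | "i = p" "j \<notin> {p, q}" | "i \<notin> {p, q}" "j = q"
      unfolding level_def using pq
      by (cases "i = p"; cases "i = q"; cases "j = p"; cases "j = q") auto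
    then show "Z $ i $ j = (n1_mat p q (\<chi> i. Z $ i $ q) + Im (Z $ p $ q) *\<^sub>R N2 p q) $ i $ j"
    proof cases
      case 1
      then show ?thesis
        using Z(1)[OF 1] pq by (auto simp: n1_mat_def N2_def level_def split: if_splits)
    next
      case 2
      then show ?thesis
        using pq pq' by (simp add: n1_mat_def N2_def scaleR_conv_of_real[where 'a = complex] mult.commute)
    qed (use pq pj in \<open>auto simp: n1_mat_def N2_def\<close>)
  qed
  then show "Z \<in> n_alg p q"
    unfolding n_alg_def n1_alg_def n2_alg_def by blast
qed

text \<open>Skewness for \<open>hform\<close> makes the entry at q minus the conjugate of the entry
  at p, so equality of the two means a common imaginary value. In this form closure under brackets
  and limits is inherited from the factors.\<close>

lemma suu_alg_eq: "suu_alg p q = {X \<in> eq_block_diag \<inter> u_alg. trace X = 0}"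
proof (intro set_eqI iffI)
  fix X
  assume X: "X \<in> suu_alg p q"
  then obtain c :: real where c: "X $ p $ p = \<i> * c" "X $ q $ q = \<i> * c"
    by (auto simp: suu_alg_def)
  have s: "cnj (X $ j $ i) = - X $ i $ j" if "i \<notin> {p, q}" "j \<notin> {p, q}" for i j
    using X that by (auto simp: suu_alg_def)
  have z: "X $ i $ j = 0" if "i \<noteq> j" "i \<in> {p, q} \<or> j \<in> {p, q}" for i j
    using X that by (auto simp: suu_alg_def)
  have "X \<in> block_diag"
    unfolding block_diag_def using z by (auto simp: level_def split: if_splits)
  moreover have "X $ flip i $ j = - cnj (X $ flip j $ i)" for i j
  proof -
    have *: "flip k = k" if "k \<notin> {p, q}" for k
      using that by (simp add: flip_def)
    consider "i \<in> {p, q}" "j \<in> {p, q}" | "i \<in> {p, q}" "j \<notin> {p, q}"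
      | "i \<notin> {p, q}" "j \<in> {p, q}" | "i \<notin> {p, q}" "j \<notin> {p, q}"
      by blast
    then show ?thesis
    proof cases
      case 1
      then show ?thesis using c z[of p q] z[of q p] pq by auto
    next
      case 2
      then show ?thesis using z[of p j] z[of q j] z[of j p] z[of j q] *[of j] by auto
    next
      case 3
      then show ?thesis using z[of p i] z[of q i] z[of i p] z[of i q] *[of i] by auto
    next
      case 4
      then show ?thesis using s[of j i] s[of i j] *[of i] *[of j] by simp
    qed
  qed
  moreover have "trace X = 0"
    using X by (simp add: suu_alg_def)
  ultimately show "X \<in> {X \<in> eq_block_diag \<inter> u_alg. trace X = 0}"
    unfolding eq_block_diag_def mem_Collect_eq Int_iff c by (blast intro: u_algI)
next
  fix X
  assume *: "X \<in> {X \<in> eq_block_diag \<inter> u_alg. trace X = 0}"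
  then have X: "X $ p $ p = X $ q $ q" "trace X = 0" "\<And>i j. level i \<noteq> level j \<Longrightarrow> X $ i $ j = 0"
    by (auto simp: eq_block_diag_def block_diag_def)
  have X4: "X $ flip i $ j = - cnj (X $ flip j $ i)" for i j
    using * u_algD by blast
  have "Re (X $ p $ p) = 0"
    using X4[of p q] X(1) by (simp add: complex_eq_iff)
  then have "X $ p $ p = \<i> * of_real (Im (X $ p $ p))"
    by (simp add: complex_eq_iff)
  moreover have "cnj (X $ j $ i) = - X $ i $ j" if "i \<notin> {p, q}" "j \<notin> {p, q}" for i j
    using X4[of i j] that by (simp add: flip_def)
  moreover have "X $ i $ j = 0" if "i \<noteq> j" "i \<in> {p, q} \<or> j \<in> {p, q}" for i j
    using X(3)[of i j] that pq by (auto simp: level_def split: if_splits)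
  ultimately show "X \<in> suu_alg p q"
    using X(1,2) by (auto simp: suu_alg_def)
qed

text \<open>Here skewness for the indefinite form agrees with ordinary skewness, since the entries
  at p and q are one imaginary number. This makes ad skew for the Euclidean product.\<close>

lemma suu_alg_skew_hermitian:
  assumes "X \<in> suu_alg p q"
  shows "X $ j $ i = - cnj (X $ i $ j)"
proof -
  obtain c :: real where c: "X $ p $ p = \<i> * c" "X $ q $ q = \<i> * c"
    using assms by (auto simp: suu_alg_def)
  have s: "X $ j $ i = - cnj (X $ i $ j)" if "i \<notin> {p, q}" "j \<notin> {p, q}" for i j
  proof -
    have "cnj (X $ i $ j) = - X $ j $ i"
      using assms that by (auto simp: suu_alg_def)
    then show ?thesis
      by simp
  qed
  have z: "X $ i $ j = 0" if "i \<noteq> j" "i \<in> {p, q} \<or> j \<in> {p, q}" for i j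
    using assms that by (auto simp: suu_alg_def)
  show ?thesis
    using c s[of i j] z[of i j] z[of j i]
    by (cases "i \<in> {p, q}"; cases "j \<in> {p, q}"; cases "i = j") auto
qed

text \<open>\<open>A0 p q\<close> is the grading element: coordinate i has weight 1 - level i, so
  its adjoint action multiplies entry (i, j) by level j - level i.\<close>

lemma A0_entry: "A0 p q $ i $ j = (if i = j then of_real (1 - real (level i)) else 0)"
  using pq by (auto simp: A0_def level_def)

lemma A0_mult: "(A0 p q ** X) $ i $ j = of_real (1 - real (level i)) * X $ i $ j"
  and mult_A0: "(X ** A0 p q) $ i $ j = X $ i $ j * of_real (1 - real (level j))"
  by (simp_all add: mult_entry A0_entry if_distrib[where f = "\<lambda>x. x * _"]
      if_distrib[where f = "\<lambda>x. _ * x"] cong: if_cong)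

lemma A0_block_diag: "A0 p q \<in> block_diag"
  by (simp add: block_diag_def A0_entry)

lemma A0_u_alg: "A0 p q \<in> u_alg"
proof (rule u_algI)
  fix i j
  show "A0 p q $ flip i $ j = - cnj (A0 p q $ flip j $ i)"
    using pq by (cases "i = p"; cases "i = q"; cases "j = p"; cases "j = q") (simp_all add: A0_def flip_def)
qed

lemma trace_A0: "trace (A0 p q) = 0"
proof -
  have "trace (A0 p q) = (\<Sum>i\<in>UNIV. (if i = p then 1 else 0) - (if i = q then 1 else 0))"
    unfolding trace_def using pq by (intro sum.cong) (auto simp: A0_def)
  then show ?thesis
    by (simp add: sum_subtractf)
qed

lemma A0_commute: "X \<in> block_diag \<Longrightarrow> A0 p q ** X = X ** A0 p q"
  by (auto simp: vec_eq_iff A0_mult mult_A0 block_diag_def mult.commute)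

text \<open>The centralizer of \<open>A0 p q\<close> in su(n,1), that is s(u(n-1)+u(1)) + a.\<close>

definition l_alg :: "'i cmat set" where
  "l_alg = {X \<in> block_diag \<inter> u_alg. trace X = 0}"

lemma suu_alg_subset_l_alg: "suu_alg p q \<subseteq> l_alg"
  by (auto simp: suu_alg_eq l_alg_def eq_block_diag_def)

lemma trace_scaleR: "trace (t *\<^sub>R X) = t *\<^sub>R trace X" for X :: "'i cmat"
  by (simp add: trace_def scaleR_sum_right)

text \<open>The entries at p and q are z and minus the conjugate of z; removing Re z times
  \<open>A0 p q\<close> leaves i Im z in both places.\<close>

lemma l_alg_decomp:
  assumes "X \<in> l_alg"
  shows "X - Re (X $ p $ p) *\<^sub>R A0 p q \<in> suu_alg p q"
proof -
  let ?Y = "X - Re (X $ p $ p) *\<^sub>R A0 p q"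
  have X: "X \<in> block_diag" "X \<in> u_alg" "trace X = 0"
    using assms by (auto simp: l_alg_def)
  have "X $ q $ q = - cnj (X $ p $ p)"
    using u_algD[OF X(2), of p q] by simp
  then have "?Y $ p $ p = ?Y $ q $ q"
    by (simp add: A0_entry complex_eq_iff)
  moreover have "?Y \<in> block_diag" "?Y \<in> u_alg"
    by (intro subspace_diff subspace_scale subspace_block_diag subspace_u_alg X A0_block_diag A0_u_alg)+
  moreover have "trace ?Y = 0"
    by (simp add: trace_sub trace_scaleR X(3) trace_A0)
  ultimately show ?thesis
    by (simp add: suu_alg_eq eq_block_diag_def)
qed

lemma subspace_suu_alg: "subspace (suu_alg p q)"
  unfolding suu_alg_eq using subspace_eq_block_diag subspace_u_alg
  by (auto simp: subspace_def trace_add trace_scaleR) (simp add: trace_def)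

lemma A0_scale_mem_suu_alg: "t *\<^sub>R A0 p q \<in> suu_alg p q \<Longrightarrow> t = 0"
  by (auto simp: suu_alg_eq eq_block_diag_def A0_entry)

lemma bracket_strict_upper: "X \<in> upper \<Longrightarrow> Z \<in> strict_upper \<Longrightarrow> bracket X Z \<in> strict_upper"
  unfolding bracket_def
  by (intro subspace_diff subspace_strict_upper mult_strict_upper_left mult_strict_upper_right)

lemma bracket_l_n: "X \<in> l_alg \<Longrightarrow> Z \<in> n_alg p q \<Longrightarrow> bracket X Z \<in> n_alg p q"
  unfolding n_alg_eq l_alg_def
  using block_diag_subset_upper bracket_strict_upper bracket_u_alg by blast

lemma bracket_n_n: "Y \<in> n_alg p q \<Longrightarrow> Z \<in> n_alg p q \<Longrightarrow> bracket Y Z \<in> n_alg p q"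
  unfolding n_alg_eq
  using strict_upper_subset_upper bracket_strict_upper bracket_u_alg by blast

text \<open>The blocks at p and q are scalars, so a bracket vanishes there and has no
  a-component.\<close>

lemma bracket_l_suu: "X \<in> l_alg \<Longrightarrow> Y \<in> l_alg \<Longrightarrow> bracket X Y \<in> suu_alg p q"
  unfolding suu_alg_eq l_alg_def eq_block_diag_def
  by (auto intro!: bracket_u_alg trace_bracket)
     (auto simp: bracket_def mult_block_diag mult_pp mult_qq intro!: subspace_diff subspace_block_diag)

lemma subspace_n_alg: "subspace (n_alg p q)"
  unfolding n_alg_eq by (intro subspace_inter subspace_strict_upper subspace_u_alg)

end

section \<open>The groups of a non-symmetric description\<close>

context block_indices
begin

lemma hform_eq: "hform p q x y = (\<Sum>i\<in>UNIV. cnj (y $ flip i) * x $ i)"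
proof -
  have "(\<Sum>i\<in>UNIV. cnj (y $ flip i) * x $ i)
      = (\<Sum>i\<in>UNIV - {p, q}. cnj (y $ flip i) * x $ i) + (\<Sum>i\<in>{p, q}. cnj (y $ flip i) * x $ i)"
    by (rule sum.subset_diff) auto
  also have "(\<Sum>i\<in>UNIV - {p, q}. cnj (y $ flip i) * x $ i) = (\<Sum>i\<in>UNIV - {p, q}. cnj (y $ i) * x $ i)"
    by (intro sum.cong) (auto simp: flip_def)
  finally show ?thesis
    using pq by (simp add: hform_def)
qed

text \<open>Both constraints are derivatives at t = 0 of constants: the form on pairs of basis
  vectors, and the determinant.\<close>

lemma lie_algebra_SU:
  assumes "X \<in> lie_algebra_of (SU p q)"
  shows "X \<in> u_alg" and "trace X = 0"
proof -
  have E: "mexp (t *\<^sub>R X) \<in> SU p q" for t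
    using assms by (rule mexp_scale_mem)
  have "X $ flip b $ a = - cnj (X $ flip a $ b)" for a b
  proof -
    let ?f = "\<lambda>t. \<Sum>i\<in>UNIV. cnj (mexp (t *\<^sub>R X) $ flip i $ b) * mexp (t *\<^sub>R X) $ i $ a"
    have "?f t = hform p q (axis a 1) (axis b 1)" for t
    proof -
      have "hform p q (mexp (t *\<^sub>R X) *v axis a 1) (mexp (t *\<^sub>R X) *v axis b 1)
          = hform p q (axis a 1) (axis b 1)"
        using E[of t] by (simp add: SU_def)
      then show ?thesis
        by (subst (asm) hform_eq) (simp add: matrix_vector_axis)
    qed
    then have "(?f has_vector_derivative 0) (at 0)"
      by simp
    moreover have "(?f has_vector_derivative (\<Sum>i\<in>UNIV. cnj (mexp ((0::real) *\<^sub>R X) $ flip i $ b) * X $ i $ a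
        + cnj (X $ flip i $ b) * mexp ((0::real) *\<^sub>R X) $ i $ a)) (at 0)"
      by (intro has_vector_derivative_sum has_vector_derivative_mult has_vector_derivative_cnj
          mexp_entry_has_vector_derivative_0)
    ultimately have "(\<Sum>i\<in>UNIV. cnj (mexp ((0::real) *\<^sub>R X) $ flip i $ b) * X $ i $ a
        + cnj (X $ flip i $ b) * mexp ((0::real) *\<^sub>R X) $ i $ a) = 0"
      by (rule vector_derivative_unique_at[symmetric])
    moreover have "cnj (mexp ((0::real) *\<^sub>R X) $ flip i $ b) * X $ i $ a
        = (if i = flip b then X $ i $ a else 0)" for i
      using flip_simps(3) by (auto simp: mat_def)
    moreover have "cnj (X $ flip i $ b) * mexp ((0::real) *\<^sub>R X) $ i $ a
        = (if i = a then cnj (X $ flip i $ b) else 0)" for i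
      by (simp add: mat_def)
    ultimately have "X $ flip b $ a + cnj (X $ flip a $ b) = 0"
      by (simp only: sum.distrib) simp
    then show ?thesis
      by (simp only: add_eq_0_iff2)
  qed
  then show "X \<in> u_alg"
    by (rule u_algI)
  have "((\<lambda>t::real. det (mexp (t *\<^sub>R X))) has_vector_derivative 0) (at 0)"
    using E by (simp add: SU_def)
  then show "trace X = 0"
    by (rule vector_derivative_unique_at[OF det_mexp_has_vector_derivative_0])
qed

lemma closed_SU: "closed (SU p q)"
proof -
  have "SU p q = {g. det g = 1} \<inter> (\<Inter>X. \<Inter>Y. {g. hform p q (g *v X) (g *v Y) = hform p q X Y})"
    by (auto simp: SU_def)
  moreover have "closed {g :: 'i cmat. det g = 1}"
    unfolding det_def by (intro closed_Collect_eq continuous_intros)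
  moreover have "closed {g :: 'i cmat. hform p q (g *v X) (g *v Y) = hform p q X Y}" for X Y
    unfolding hform_def matrix_vector_mult_def
    by (intro closed_Collect_eq) (simp_all, intro continuous_intros)
  ultimately show ?thesis
    by (simp only:) (intro closed_Int closed_INT ballI)
qed

lemma mexp_eq_block_diag: "X \<in> eq_block_diag \<Longrightarrow> mexp X \<in> eq_block_diag"
  by (intro mexp_mem_subalgebra subspace_eq_block_diag one_mem_eq_block_diag mult_eq_block_diag)

lemma mexp_block_diag: "X \<in> block_diag \<Longrightarrow> mexp X \<in> block_diag"
  by (intro mexp_mem_subalgebra subspace_block_diag one_mem_block_diag mult_block_diag)

lemma suu_alg_subset_eq_block_diag: "suu_alg p q \<subseteq> eq_block_diag"
  by (auto simp: suu_alg_eq)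

lemma mexp_mem_SUU: "X \<in> suu_alg p q \<Longrightarrow> mexp X \<in> SUU p q"
  unfolding SUU_def connected_group_def by (rule subsetD[OF hull_subset]) (rule imageI)

text \<open>Minimality of the hull serves as induction over generators. Control of the inverse is
  part of the invariant, which makes \<open>?T\<close> a subgroup.\<close>

lemma SUU_eq_block_diag:
  assumes "k \<in> SUU p q"
  shows "k \<in> eq_block_diag" "invertible k" "matrix_inv k \<in> eq_block_diag"
proof -
  let ?T = "{k. k \<in> eq_block_diag \<and> invertible k \<and> matrix_inv k \<in> eq_block_diag}"
  have inv: "g ** matrix_inv g = mat 1" "matrix_inv g ** g = mat 1" if "invertible g" for g :: "'i cmat"
    using that by (rule matrix_inv_mult)+
  have "mat_subgroup ?T"
    unfolding mat_subgroup_def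
  proof (intro conjI ballI)
    have "matrix_inv (mat 1 :: 'i cmat) = mat 1"
      by (rule matrix_inv_unique) simp
    then show "mat 1 \<in> ?T"
      using one_mem_eq_block_diag by (simp add: invertible_def)
    fix x
    assume x: "x \<in> ?T"
    then show "invertible x"
      by simp
    have "matrix_inv (matrix_inv x) = x"
      using x by (intro matrix_inv_unique inv) simp
    then show "matrix_inv x \<in> ?T"
      using x inv by (auto simp: invertible_def)
    fix y
    assume y: "y \<in> ?T"
    have "x ** y ** (matrix_inv y ** matrix_inv x) = x ** (y ** matrix_inv y) ** matrix_inv x"
      by (simp add: matrix_mul_assoc)
    also have "\<dots> = mat 1"
      using x y inv by simp
    finally have "matrix_inv (x ** y) = matrix_inv y ** matrix_inv x"
      by (rule matrix_inv_unique)
    then show "x ** y \<in> ?T"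
      using x y by (simp add: mult_eq_block_diag invertible_mult)
  qed
  moreover have "mexp ` suu_alg p q \<subseteq> ?T"
    using mexp_eq_block_diag suu_alg_subset_eq_block_diag subspace_neg[OF subspace_suu_alg]
    by (auto simp: subset_iff)
  ultimately have "SUU p q \<subseteq> ?T"
    unfolding SUU_def connected_group_def by (rule hull_minimal[rotated])
  with assms show "k \<in> eq_block_diag" "invertible k" "matrix_inv k \<in> eq_block_diag"
    by auto
qed

lemma A_grp_block_diag: "A_grp p q \<subseteq> block_diag"
  unfolding A_grp_def a_alg_def
  using mexp_block_diag subspace_scale[OF subspace_block_diag A0_block_diag] by auto

lemma SUU_A_block_diag: "SUU_A p q \<subseteq> block_diag"
  unfolding SUU_A_def using SUU_eq_block_diag(1) A_grp_block_diag eq_block_diag_subset mult_block_diag by blast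

text \<open>The a-component commutes with all block diagonal matrices, so the exponential splits
  into its two factors.\<close>

lemma mexp_l_alg_mem_SUU_A:
  assumes "X \<in> l_alg"
  shows "mexp X \<in> SUU_A p q"
proof -
  define t where "t = Re (X $ p $ p)"
  define Y where "Y = X - t *\<^sub>R A0 p q"
  have Y: "Y \<in> suu_alg p q"
    unfolding Y_def t_def using assms by (rule l_alg_decomp)
  have "Y \<in> block_diag"
    using Y suu_alg_subset_eq_block_diag eq_block_diag_subset by blast
  then have "Y ** (t *\<^sub>R A0 p q) = (t *\<^sub>R A0 p q) ** Y"
    using A0_commute[of Y] by (simp add: mm.scaleR_left mm.scaleR_right)
  then have "mexp X = mexp Y ** mexp (t *\<^sub>R A0 p q)"
    using mexp_add_commuting[of Y "t *\<^sub>R A0 p q"] by (simp add: Y_def)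
  then show ?thesis
    unfolding SUU_A_def A_grp_def a_alg_def using mexp_mem_SUU[OF Y] by blast
qed

lemma mexp_pp:
  assumes "X \<in> block_diag"
  shows "mexp X $ p $ p = exp (X $ p $ p)" "mexp X $ q $ q = exp (X $ q $ q)"
proof -
  have pow: "((**) X ^^ k) (mat 1) $ p $ p = X $ p $ p ^ k" "((**) X ^^ k) (mat 1) $ q $ q = X $ q $ q ^ k" for k
    by (induction k) (simp_all add: mult_pp mult_qq assms, simp_all add: mat_def)
  have "(\<lambda>k. ((1 / fact k) *\<^sub>R (((**) X ^^ k) (mat 1))) $ i $ i) sums mexp X $ i $ i" for i
    by (intro bounded_linear.sums[OF bounded_linear_vec_nth] mexp_converges)
  from this[of p] this[of q] show "mexp X $ p $ p = exp (X $ p $ p)" "mexp X $ q $ q = exp (X $ q $ q)"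
    unfolding vector_scaleR_component pow
    using sums_unique2[OF _ exp_converges] by (simp_all add: divide_inverse)
qed

lemma A_grp_eq_block_diag:
  assumes "a \<in> A_grp p q" "a \<in> eq_block_diag"
  shows "a = mat 1"
proof -
  obtain t where a: "a = mexp (t *\<^sub>R A0 p q)"
    using assms(1) by (auto simp: A_grp_def a_alg_def)
  have bd: "t *\<^sub>R A0 p q \<in> block_diag"
    by (intro subspace_scale subspace_block_diag A0_block_diag)
  have "exp (of_real t :: complex) = exp (of_real (- t))"
    using assms(2) mexp_pp[OF bd] by (simp add: a eq_block_diag_def A0_entry scaleR_conv_of_real[where 'a = complex])
  then have "t = 0"
    unfolding exp_of_real of_real_eq_iff by simp
  then show ?thesis
    by (simp add: a)
qed

end

section \<open>The Lie algebras of F, H and G\<close>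

locale nonsymmetric = block_indices p q for p q :: "'i::finite" +
  fixes F G H :: "'i cmat set"
  assumes description: "nonsymmetric_description p q F G H"
    and G_SU: "G \<subseteq> SU p q"
begin

lemma subgroup_F: "mat_subgroup F" and F_SUU_A: "F \<subseteq> SUU_A p q"
  and closed_F: "closedin (top_of_set (SUU_A p q)) F" and connected_F: "connected F"
  and proj_F: "proj_A p q F \<noteq> {mat 1}" and G_eq: "G = {f ** u | f u. f \<in> F \<and> u \<in> N_grp p q}"
  and H_eq: "H = F \<inter> SUU p q"
  using description by (auto simp: nonsymmetric_description_def)

lemma F_block_diag: "F \<subseteq> block_diag"
  using F_SUU_A SUU_A_block_diag by blast

lemma F_subset_G: "F \<subseteq> G"
proof
  fix f
  assume "f \<in> F"
  moreover have "mat 1 \<in> N_grp p q"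
    unfolding N_grp_def using subspace_0[OF subspace_n_alg] mexp_0 by (metis image_eqI)
  ultimately show "f \<in> G"
    unfolding G_eq by (intro CollectI exI[of _ f] exI[of _ "mat 1"]) simp
qed

lemma lie_closure_F: "lie_algebra_of (closure F) \<subseteq> l_alg"
proof
  fix X
  assume X: "X \<in> lie_algebra_of (closure F)"
  have "closure F \<subseteq> SU p q" "closure F \<subseteq> block_diag"
    using F_subset_G G_SU F_block_diag closure_minimal[OF _ closed_SU, of F]
      closure_minimal[OF _ closed_subspace[OF subspace_block_diag], of F] by auto
  with X have "X \<in> lie_algebra_of (SU p q)" "X \<in> lie_algebra_of block_diag"
    by (auto simp: lie_algebra_of_def)
  then show "X \<in> l_alg"
    using lie_algebra_SU mem_subspace_if_mexp_mem[OF subspace_block_diag one_mem_block_diag]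
    by (auto simp: l_alg_def lie_algebra_of_def)
qed

text \<open>F is the trace of a closed set T on \<open>SUU_A p q\<close>. A one-parameter group in
  \<open>closure F\<close> lies in T, and in \<open>SUU_A p q\<close> because its generator lies in
  \<open>l_alg\<close>.\<close>

sublocale F: lie_closed_subgroup F
proof
  show "lie_algebra_of (closure F) \<subseteq> lie_algebra_of F"
  proof
    fix X
    assume X: "X \<in> lie_algebra_of (closure F)"
    obtain T where T: "closed T" "F = SUU_A p q \<inter> T"
      using closed_F by (auto simp: closedin_closed)
    then have "closure F \<subseteq> T"
      by (intro closure_minimal) auto
    moreover have "mexp (t *\<^sub>R X) \<in> SUU_A p q" for t
      using lie_closure_F lie_algebra_of_scale[OF X] mexp_l_alg_mem_SUU_A by blast
    ultimately show "X \<in> lie_algebra_of F"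
      using X T(2) by (auto simp: lie_algebra_of_def)
  qed
qed (rule subgroup_F)

lemma lie_F_subset: "lie_algebra_of F \<subseteq> l_alg"
  using lie_closure_F closure_subset by (fastforce simp: lie_algebra_of_def)

lemma lie_H_eq: "lie_algebra_of H = lie_algebra_of F \<inter> suu_alg p q"
proof (intro equalityI subsetI IntI)
  fix X
  assume X: "X \<in> lie_algebra_of H"
  then show XF: "X \<in> lie_algebra_of F"
    by (auto simp: lie_algebra_of_def H_eq)
  have "mexp (t *\<^sub>R X) \<in> eq_block_diag" for t
    using mexp_scale_mem[OF X, of t] SUU_eq_block_diag(1) by (auto simp: H_eq)
  then have "X \<in> eq_block_diag"
    by (rule mem_subspace_if_mexp_mem[OF subspace_eq_block_diag one_mem_eq_block_diag])
  then show "X \<in> suu_alg p q"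
    using XF lie_F_subset by (auto simp: suu_alg_eq l_alg_def)
next
  fix X
  assume X: "X \<in> lie_algebra_of F \<inter> suu_alg p q"
  then have "mexp (t *\<^sub>R X) \<in> SUU p q" for t
    by (intro mexp_mem_SUU subspace_scale subspace_suu_alg) auto
  then show "X \<in> lie_algebra_of H"
    using X by (auto simp: lie_algebra_of_def H_eq)
qed

text \<open>A clopen argument: near an element g of the intersection, x = g exp X with X in the Lie
  algebra of F, and both factors belong to the algebra \<open>eq_block_diag\<close>.\<close>

lemma F_subset_eq_block_diag:
  assumes "lie_algebra_of F \<subseteq> suu_alg p q"
  shows "F \<subseteq> eq_block_diag"
proof -
  let ?T = "F \<inter> eq_block_diag"
  obtain e where e: "0 < e" "\<And>g. g \<in> F \<Longrightarrow> norm (g - mat 1) < e \<Longrightarrow> g \<in> mexp ` lie_algebra_of F"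
    using F.near_one_in_mexp_image by blast
  have "closedin (top_of_set F) ?T"
    using closed_subspace[OF subspace_eq_block_diag] by (rule closedin_closed_Int)
  moreover have "openin (top_of_set F) ?T"
    unfolding openin_euclidean_subtopology_iff
  proof (intro conjI ballI)
    fix g
    assume g: "g \<in> ?T"
    let ?m = "\<lambda>x. norm (matrix_inv g ** x - mat 1)"
    have inv: "matrix_inv g ** g = mat 1" "g ** matrix_inv g = mat 1"
      using F.invertible[of g] g matrix_inv_mult by auto
    have "isCont ?m g"
      by (intro continuous_intros mm.isCont)
    then obtain d where d: "0 < d" "\<And>x. dist x g < d \<Longrightarrow> dist (?m x) (?m g) < e"
      using e(1) unfolding continuous_at_eps_delta by blast
    show "\<exists>d>0. \<forall>x\<in>F. dist x g < d \<longrightarrow> x \<in> ?T"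
    proof (intro exI conjI ballI impI)
      fix x
      assume x: "x \<in> F" "dist x g < d"
      then have "?m x < e"
        using d(2)[of x] inv(1) by simp
      moreover have "matrix_inv g ** x \<in> F"
        using g x(1) by (intro F.mult_mem F.inv_mem) auto
      ultimately obtain X where "X \<in> lie_algebra_of F" "matrix_inv g ** x = mexp X"
        using e(2) by blast
      then have "matrix_inv g ** x \<in> eq_block_diag"
        using assms suu_alg_subset_eq_block_diag mexp_eq_block_diag[of X] by auto
      then have "g ** (matrix_inv g ** x) \<in> eq_block_diag"
        using g mult_eq_block_diag[of g "matrix_inv g ** x"] by blast
      then show "x \<in> ?T"
        using x(1) inv(2) by (simp add: matrix_mul_assoc)
    qed (rule d(1))
  qed auto
  moreover have "?T \<noteq> {}"
    using F.one_mem one_mem_eq_block_diag by blast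
  ultimately show ?thesis
    using connected_F unfolding connected_clopen by blast
qed

lemma lie_F_not_subset: "\<not> lie_algebra_of F \<subseteq> suu_alg p q"
proof
  assume "lie_algebra_of F \<subseteq> suu_alg p q"
  then have F: "F \<subseteq> eq_block_diag"
    by (rule F_subset_eq_block_diag)
  have "a = mat 1" if "a \<in> proj_A p q F" for a
  proof -
    obtain k where k: "k \<in> SUU p q" "k ** a \<in> F" and a: "a \<in> A_grp p q"
      using \<open>a \<in> proj_A p q F\<close> by (auto simp: proj_A_def)
    have "matrix_inv k ** k = mat 1"
      using SUU_eq_block_diag(2)[OF k(1)] by (rule matrix_inv_mult)
    then have "matrix_inv k ** (k ** a) = a"
      by (simp add: matrix_mul_assoc)
    moreover have "matrix_inv k ** (k ** a) \<in> eq_block_diag"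
      by (rule mult_eq_block_diag[OF SUU_eq_block_diag(3)[OF k(1)] subsetD[OF F k(2)]])
    ultimately show ?thesis
      using A_grp_eq_block_diag[OF a] by simp
  qed
  \<comment> \<open>\<open>proj_F\<close> would also be met by an empty projection, so membership of
    1 is needed for the contradiction.\<close>
  moreover have "mat 1 \<in> proj_A p q F"
  proof -
    have "mat 1 \<in> SUU p q"
      using mexp_mem_SUU[OF subspace_0[OF subspace_suu_alg]] by simp
    moreover have "mat 1 \<in> A_grp p q"
      unfolding A_grp_def a_alg_def using mexp_0 by (force intro: image_eqI[of _ _ "0"] rev_image_eqI[of 0])
    ultimately show ?thesis
      using F.one_mem by (force simp: proj_A_def)
  qed
  ultimately show False
    using proj_F by blast
qed

text \<open>Elements of N are exponentials of strictly upper matrices and have block diagonal part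
  1, so the part of a product f u is f.\<close>

lemma G_upper: "G \<subseteq> upper" and diag_part_G: "g \<in> G \<Longrightarrow> diag_part g \<in> F"
proof -
  have N: "u \<in> upper \<and> diag_part u = mat 1" if u: "u \<in> N_grp p q" for u
  proof -
    obtain Z where Z: "u = mexp Z" "Z \<in> strict_upper"
      using u by (auto simp: N_grp_def n_alg_eq)
    have "mat 1 \<in> upper" "Z \<in> upper"
      using one_mem_block_diag block_diag_subset_upper strict_upper_subset_upper Z by auto
    then show ?thesis
      using Z mexp_mem_subalgebra[OF subspace_upper _ mult_upper, of Z]
      by (simp add: diag_part_mexp diag_part_strict_upper)
  qed
  then show "G \<subseteq> upper"
    using F_block_diag block_diag_subset_upper mult_upper by (fastforce simp: G_eq)
  show "diag_part g \<in> F" if "g \<in> G"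
  proof -
    obtain f u where g: "g = f ** u" "f \<in> F" "u \<in> N_grp p q"
      using \<open>g \<in> G\<close> by (auto simp: G_eq)
    have "f \<in> block_diag" "f \<in> upper"
      using g F_block_diag block_diag_subset_upper by auto
    then show ?thesis
      using g N[OF g(3)] by (simp add: diag_part_mult diag_part_block_diag)
  qed
qed

lemma lie_G_decomp:
  assumes "X \<in> lie_algebra_of G"
  shows "diag_part X \<in> lie_algebra_of F" and "X - diag_part X \<in> n_alg p q"
proof -
  have upper: "X \<in> upper"
    by (rule mem_subspace_if_mexp_mem[OF subspace_upper])
       (use one_mem_block_diag block_diag_subset_upper G_upper mexp_scale_mem[OF assms] in blast)+
  have "mexp (t *\<^sub>R diag_part X) = diag_part (mexp (t *\<^sub>R X))" for t
    by (simp add: diag_part_mexp subspace_scale[OF subspace_upper] upper linear_cmul[OF linear_diag_part])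
  then show XF: "diag_part X \<in> lie_algebra_of F"
    using diag_part_G[OF mexp_scale_mem[OF assms]] by (simp add: lie_algebra_of_def)
  have "X \<in> lie_algebra_of (SU p q)"
    using assms G_SU by (auto simp: lie_algebra_of_def)
  then have "X \<in> u_alg"
    by (rule lie_algebra_SU)
  then show "X - diag_part X \<in> n_alg p q"
    unfolding n_alg_eq using minus_diag_part_mem[OF upper]
    by (simp add: subspace_diff[OF subspace_u_alg] diag_part_u_alg)
qed

lemma lie_F_subset_lie_G: "lie_algebra_of F \<subseteq> lie_algebra_of G"
  using F_subset_G by (auto simp: lie_algebra_of_def)

lemma n_alg_subset_lie_G: "n_alg p q \<subseteq> lie_algebra_of G"
proof
  fix Z
  assume "Z \<in> n_alg p q"
  then have N: "mexp (t *\<^sub>R Z) \<in> N_grp p q" for t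
    unfolding N_grp_def using subspace_scale[OF subspace_n_alg] by blast
  show "Z \<in> lie_algebra_of G"
  proof (rule lie_algebra_of_memI)
    show "mexp (t *\<^sub>R Z) \<in> G" for t
      unfolding G_eq using N[of t] F.one_mem
      by (intro CollectI exI[of _ "mat 1"] exI[of _ "mexp (t *\<^sub>R Z)"]) simp
  qed
qed

end

section \<open>Holonomy of the canonical connection\<close>

lemma ctranspose_mult: "ctranspose (X ** Y) = ctranspose Y ** ctranspose X" for X Y :: "'i::finite cmat"
  by (simp add: ctranspose_def matrix_matrix_mult_def vec_eq_iff mult.commute)

text \<open>Identifying \<open>kform\<close> with the standard inner product gives access to
  orthogonal decompositions.\<close>

lemma kform_eq_inner: "kform E E' = E \<bullet> E'" for E E' :: "'i::finite cmat"
proof -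
  have "kform E E' = (\<Sum>i\<in>UNIV. \<Sum>j\<in>UNIV. E $ j $ i \<bullet> E' $ j $ i)"
    by (simp add: kform_def trace_def ctranspose_def matrix_matrix_mult_def inner_complex_def)
  also have "\<dots> = E \<bullet> E'"
    by (subst sum.swap) (simp add: inner_vec_def)
  finally show ?thesis .
qed

lemma bounded_bilinear_bracket: "bounded_bilinear (bracket :: 'i::finite cmat \<Rightarrow> _)"
proof (rule bilinear_conv_bounded_bilinear[THEN iffD1], unfold bilinear_def, intro conjI allI)
  fix X :: "'i cmat"
  show "linear (bracket X)" "linear (\<lambda>Y. bracket Y X)"
    by (rule linearI; simp add: bracket_def mm.add_left mm.add_right mm.scaleR_left mm.scaleR_right
        scaleR_diff_right)+
qed

interpretation br: bounded_bilinear "bracket :: 'i::finite cmat \<Rightarrow> _"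
  by (rule bounded_bilinear_bracket)

lemma bracket_skew: "bracket X Y = - bracket Y X"
  by (simp add: bracket_def)

lemma inner_bracket_skew_hermitian:
  fixes X Y Z :: "'i::finite cmat"
  assumes "ctranspose X = - X"
  shows "bracket X Y \<bullet> Z = - (Y \<bullet> bracket X Z)"
proof -
  have "trace (ctranspose (X ** Y) ** Z) = - trace (ctranspose Y ** (X ** Z))"
    by (simp add: ctranspose_mult assms mm.minus_right mm.minus_left trace_def sum_negf
        flip: matrix_mul_assoc)
  moreover have "trace (ctranspose (Y ** X) ** Z) = - trace (ctranspose Y ** (Z ** X))"
    using trace_mul_sym[of X "ctranspose Y ** Z"]
    by (simp add: ctranspose_mult assms mm.minus_right mm.minus_left trace_def sum_negf matrix_mul_assoc)
  ultimately have "(X ** Y) \<bullet> Z = - (Y \<bullet> (X ** Z))" "(Y ** X) \<bullet> Z = - (Y \<bullet> (Z ** X))"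
    unfolding kform_eq_inner[symmetric] kform_def by simp_all
  then show ?thesis
    by (simp add: bracket_def inner_diff_left inner_diff_right)
qed

context block_indices
begin

lemma ctranspose_suu_alg:
  assumes "X \<in> suu_alg p q"
  shows "ctranspose X = - X"
proof -
  have "ctranspose X $ i $ j = (- X) $ i $ j" for i j
    using suu_alg_skew_hermitian[OF assms, of i j] by (simp add: ctranspose_def)
  then show ?thesis
    by (simp add: vec_eq_iff)
qed

text \<open>Entries of Z live where level j > level i, so every eigenvalue of ad
  \<open>A0 p q\<close> on n is 1 or 2.\<close>

lemma bracket_A0_positive:
  assumes "Z \<in> n_alg p q"
  shows "Z \<bullet> Z \<le> bracket (A0 p q) Z \<bullet> Z"
proof -
  have "Z $ i $ j \<bullet> Z $ i $ j \<le> bracket (A0 p q) Z $ i $ j \<bullet> Z $ i $ j" for i j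
  proof (cases "level j \<le> level i")
    case True
    then have "Z $ i $ j = 0"
      using assms by (simp add: n_alg_eq strict_upper_def)
    then show ?thesis
      by simp
  next
    case False
    have "bracket (A0 p q) Z $ i $ j = (real (level j) - real (level i)) *\<^sub>R Z $ i $ j"
      by (simp add: bracket_def A0_mult mult_A0 scaleR_conv_of_real[where 'a = complex] algebra_simps)
    moreover have "1 * (Z $ i $ j \<bullet> Z $ i $ j)
        \<le> (real (level j) - real (level i)) * (Z $ i $ j \<bullet> Z $ i $ j)"
      using False by (intro mult_right_mono) auto
    ultimately show ?thesis
      by simp
  qed
  then show ?thesis
    unfolding inner_vec_def by (intro sum_mono)
qed

lemma suu_alg_diff_scale: "X \<in> suu_alg p q \<Longrightarrow> Y \<in> suu_alg p q \<Longrightarrow> X - c *\<^sub>R Y \<in> suu_alg p q"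
  by (rule subspace_diff[OF subspace_suu_alg _ subspace_scale[OF subspace_suu_alg]])

lemma bracket_image_n_alg:
  assumes B: "B - A0 p q \<in> suu_alg p q"
  shows "bracket B ` n_alg p q = n_alg p q"
proof (rule subspace_dim_equal)
  have lin: "linear (bracket B)"
    by (rule bounded_linear.linear[OF br.bounded_linear_right])
  have "A0 p q \<in> l_alg"
    by (simp add: l_alg_def A0_block_diag A0_u_alg trace_A0)
  have sub: "bracket B Z \<in> n_alg p q" if "Z \<in> n_alg p q" for Z
  proof -
    have "bracket B Z = bracket (B - A0 p q) Z + bracket (A0 p q) Z"
      by (simp add: br.diff_left)
    then show ?thesis
      using bracket_l_n[OF _ that] B suu_alg_subset_l_alg \<open>A0 p q \<in> l_alg\<close>
      by (auto intro: subspace_add[OF subspace_n_alg])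
  qed
  then show "bracket B ` n_alg p q \<subseteq> n_alg p q"
    by blast
  show "subspace (bracket B ` n_alg p q)"
    by (rule linear_subspace_image[OF lin subspace_n_alg])
  \<comment> \<open>Pairing [B, Z] with Z removes the skew part and leaves only
    \<open>A0 p q\<close>, whose positivity kills Z. Equal dimensions then turn injectivity into
    surjectivity.\<close>
  have "Z = 0" if Z: "Z \<in> n_alg p q" "bracket B Z = 0" for Z
  proof -
    have "bracket (B - A0 p q) Z \<bullet> Z = 0"
      using inner_bracket_skew_hermitian[OF ctranspose_suu_alg[OF B], of Z Z] by (simp add: inner_commute)
    then have "bracket (A0 p q) Z \<bullet> Z = 0"
      using Z(2) by (simp add: br.diff_left)
    then show ?thesis
      using bracket_A0_positive[OF Z(1)] by (metis inner_eq_zero_iff inner_ge_zero order_antisym)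
  qed
  then have "inj_on (bracket B) (n_alg p q)"
    using linear_inj_on_iff_eq_0[OF lin subspace_n_alg] by blast
  then have "dim (bracket B ` n_alg p q) = dim (n_alg p q)"
    by (intro dim_image_eq lin) (simp add: span_eq_iff[THEN iffD2, OF subspace_n_alg])
  then show "dim (n_alg p q) \<le> dim (bracket B ` n_alg p q)"
    by simp
qed (rule subspace_n_alg)

end

section \<open>The orthogonal complement of h in f and the space s_r\<close>

context nonsymmetric
begin

lemma lie_H_subset_l_alg: "lie_algebra_of H \<subseteq> l_alg"
  using lie_H_eq suu_alg_subset_l_alg by blast

lemma subspace_lie_H: "subspace (lie_algebra_of H)"
  unfolding lie_H_eq by (intro subspace_inter F.subspace_lie subspace_suu_alg)

lemma bracket_lie_H: "X \<in> lie_algebra_of H \<Longrightarrow> Y \<in> lie_algebra_of H \<Longrightarrow> bracket X Y \<in> lie_algebra_of H"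
  unfolding lie_H_eq using F.bracket_lie_mem bracket_l_suu suu_alg_subset_l_alg by blast

text \<open>An element of f outside s(u(n-1)+u(1)) is normalized to
  \<open>A0 p q\<close>-coefficient 1, and its projection to h is subtracted, which leaves that
  coefficient alone. Any other E orthogonal to h differs from a multiple of A by an element of h
  orthogonal to itself.\<close>

lemma ar_alg_spanned:
  obtains A where "ar_alg F H = range (\<lambda>t::real. t *\<^sub>R A)" and "A - A0 p q \<in> suu_alg p q"
proof -
  obtain X where X: "X \<in> lie_algebra_of F" "X \<notin> suu_alg p q"
    using lie_F_not_subset by blast
  define a where "a = Re (X $ p $ p)"
  have Xa: "X - a *\<^sub>R A0 p q \<in> suu_alg p q"
    unfolding a_def using X(1) lie_F_subset by (intro l_alg_decomp) auto
  with X(2) have a: "a \<noteq> 0"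
    by auto
  obtain Y A where Y: "Y \<in> span (lie_algebra_of H)" and orth: "\<And>W. W \<in> span (lie_algebra_of H) \<Longrightarrow> orthogonal A W"
    and XYA: "X /\<^sub>R a = Y + A"
    using orthogonal_subspace_decomp_exists[of "lie_algebra_of H" "X /\<^sub>R a"] by metis
  have YH: "Y \<in> lie_algebra_of H" and orthH: "\<And>W. W \<in> lie_algebra_of H \<Longrightarrow> A \<bullet> W = 0"
    using Y orth subspace_lie_H by (simp_all add: span_eq_iff[THEN iffD2] orthogonal_def)
  have A: "A = X /\<^sub>R a - Y"
    using XYA by simp
  have AF: "A \<in> lie_algebra_of F"
    unfolding A using X(1) YH lie_H_eq
    by (intro subspace_diff[OF F.subspace_lie] subspace_scale[OF F.subspace_lie]) auto
  have "A - A0 p q = (X - a *\<^sub>R A0 p q) /\<^sub>R a - Y"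
    using a by (simp add: A algebra_simps)
  also have "\<dots> \<in> suu_alg p q"
    by (rule subspace_diff[OF subspace_suu_alg subspace_scale[OF subspace_suu_alg Xa]])
       (use YH lie_H_eq in blast)
  finally have AA0: "A - A0 p q \<in> suu_alg p q" .
  have "ar_alg F H = range (\<lambda>t::real. t *\<^sub>R A)"
  proof (intro equalityI subsetI)
    fix E
    assume "E \<in> ar_alg F H"
    then have E: "E \<in> lie_algebra_of F" "\<And>W. W \<in> lie_algebra_of H \<Longrightarrow> E \<bullet> W = 0"
      by (auto simp: ar_alg_def kform_eq_inner)
    define b where "b = Re (E $ p $ p)"
    have "E - b *\<^sub>R A = (E - b *\<^sub>R A0 p q) - b *\<^sub>R (A - A0 p q)"
      by (simp add: algebra_simps)
    also have "\<dots> \<in> suu_alg p q"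
      unfolding b_def using E(1) lie_F_subset AA0
      by (intro suu_alg_diff_scale l_alg_decomp) auto
    finally have "E - b *\<^sub>R A \<in> lie_algebra_of H"
      unfolding lie_H_eq using E(1) AF
      by (intro IntI subspace_diff[OF F.subspace_lie] subspace_scale[OF F.subspace_lie]) auto
    then have "(E - b *\<^sub>R A) \<bullet> (E - b *\<^sub>R A) = 0"
      by (simp only: inner_diff_left[of E "b *\<^sub>R A" "E - b *\<^sub>R A"] inner_scaleR_left E(2) orthH)
    then show "E \<in> range (\<lambda>t::real. t *\<^sub>R A)"
      by (intro range_eqI[of _ _ b]) simp
  next
    fix E
    assume "E \<in> range (\<lambda>t::real. t *\<^sub>R A)"
    then show "E \<in> ar_alg F H"
      using AF orthH subspace_scale[OF F.subspace_lie] by (auto simp: ar_alg_def kform_eq_inner)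
  qed
  then show ?thesis
    using AA0 by (rule that)
qed

abbreviation "A_r \<equiv> Ar p q F H"

lemma ar_alg_eq: "ar_alg F H = range (\<lambda>t::real. t *\<^sub>R A_r)" and A_r_minus_A0: "A_r - A0 p q \<in> suu_alg p q"
proof -
  obtain A where A: "ar_alg F H = range (\<lambda>t::real. t *\<^sub>R A)" "A - A0 p q \<in> suu_alg p q"
    by (rule ar_alg_spanned)
  have "A_r = A"
    unfolding Ar_def
  proof (rule the_equality)
    fix X
    assume X: "ar_alg F H = range (\<lambda>t::real. t *\<^sub>R X) \<and> X - A0 p q \<in> suu_alg p q"
    then have "X \<in> range (\<lambda>t::real. t *\<^sub>R A)"
      using A(1) by (metis rangeI scaleR_one)
    then obtain t where t: "X = t *\<^sub>R A"
      by blast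
    have "(t - 1) *\<^sub>R A0 p q = (X - A0 p q) - t *\<^sub>R (A - A0 p q)"
      by (simp add: t algebra_simps)
    also have "\<dots> \<in> suu_alg p q"
      using X A(2) by (intro suu_alg_diff_scale) auto
    finally have "t - 1 = 0"
      by (rule A0_scale_mem_suu_alg)
    then show "X = A"
      by (simp add: t)
  qed (use A in blast)
  with A show "ar_alg F H = range (\<lambda>t::real. t *\<^sub>R A_r)" "A_r - A0 p q \<in> suu_alg p q"
    by auto
qed

lemma A_r_mem: "A_r \<in> lie_algebra_of F" and A_r_orthogonal: "X \<in> lie_algebra_of H \<Longrightarrow> A_r \<bullet> X = 0"
proof -
  have "A_r \<in> ar_alg F H"
    unfolding ar_alg_eq by (metis rangeI scaleR_one)
  then show "A_r \<in> lie_algebra_of F" "X \<in> lie_algebra_of H \<Longrightarrow> A_r \<bullet> X = 0"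
    by (auto simp: ar_alg_def kform_eq_inner)
qed

lemma A_r_l_alg: "A_r \<in> l_alg"
  using A_r_mem lie_F_subset by blast

text \<open>[X, A_r] lies in h since brackets of f lose their a-component. As ad X is skew, the
  squared norm of [X, A_r] is minus the pairing of A_r with [X, [X, A_r]], an element of h, hence
  0.\<close>

lemma bracket_lie_H_A_r:
  assumes X: "X \<in> lie_algebra_of H"
  shows "bracket X A_r = 0"
proof -
  have "bracket X A_r \<in> lie_algebra_of H"
    unfolding lie_H_eq using X A_r_mem A_r_l_alg lie_H_subset_l_alg lie_H_eq
    by (intro IntI F.bracket_lie_mem bracket_l_suu) auto
  moreover have "ctranspose X = - X"
    using X by (intro ctranspose_suu_alg) (simp add: lie_H_eq)
  ultimately have "bracket X A_r \<bullet> bracket X A_r = 0"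
    using inner_bracket_skew_hermitian[of X A_r "bracket X A_r"] A_r_orthogonal[OF bracket_lie_H[OF X]] by simp
  then show ?thesis
    by simp
qed

lemma sr_alg_eq: "sr_alg p q F H = {t *\<^sub>R A_r + Z | t Z. Z \<in> n_alg p q}"
  by (auto simp: sr_alg_def ar_alg_eq)

lemma n_alg_subset_sr_alg: "n_alg p q \<subseteq> sr_alg p q F H"
proof
  fix Z
  assume "Z \<in> n_alg p q"
  then show "Z \<in> sr_alg p q F H"
    unfolding sr_alg_eq by (intro CollectI exI[of _ 0] exI[of _ Z]) simp
qed

lemma A_r_mem_sr_alg: "A_r \<in> sr_alg p q F H"
  unfolding sr_alg_eq using subspace_0[OF subspace_n_alg] by (intro CollectI exI[of _ 1] exI[of _ 0]) simp

lemma subspace_sr_alg: "subspace (sr_alg p q F H)"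
proof (rule subspaceI)
  show "0 \<in> sr_alg p q F H"
    using n_alg_subset_sr_alg subspace_0[OF subspace_n_alg] by blast
  fix X Y :: "'i cmat" and c :: real
  assume "X \<in> sr_alg p q F H"
  then obtain t Z where X: "X = t *\<^sub>R A_r + Z" "Z \<in> n_alg p q"
    by (auto simp: sr_alg_eq)
  then show "c *\<^sub>R X \<in> sr_alg p q F H"
    unfolding sr_alg_eq
    by (intro CollectI exI[of _ "c * t"] exI[of _ "c *\<^sub>R Z"])
       (simp add: scaleR_add_right subspace_scale[OF subspace_n_alg])
  assume "Y \<in> sr_alg p q F H"
  then obtain s W where Y: "Y = s *\<^sub>R A_r + W" "W \<in> n_alg p q"
    by (auto simp: sr_alg_eq)
  then show "X + Y \<in> sr_alg p q F H"
    unfolding sr_alg_eq using X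
    by (intro CollectI exI[of _ "t + s"] exI[of _ "Z + W"])
       (simp add: scaleR_add_left subspace_add[OF subspace_n_alg])
qed

lemma bracket_lie_H_sr:
  assumes "X \<in> lie_algebra_of H" "Y \<in> sr_alg p q F H"
  shows "bracket X Y \<in> n_alg p q"
proof -
  obtain t Z where Y: "Y = t *\<^sub>R A_r + Z" "Z \<in> n_alg p q"
    using assms(2) by (auto simp: sr_alg_eq)
  then show ?thesis
    using assms(1) lie_H_subset_l_alg
    by (auto simp: br.add_right br.scaleR_right bracket_lie_H_A_r intro: bracket_l_n)
qed

lemma bracket_sr_sr:
  assumes "X \<in> sr_alg p q F H" "Y \<in> sr_alg p q F H"
  shows "bracket X Y \<in> n_alg p q"
proof -
  obtain t Z where X: "X = t *\<^sub>R A_r + Z" "Z \<in> n_alg p q"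
    using assms(1) by (auto simp: sr_alg_eq)
  obtain s W where Y: "Y = s *\<^sub>R A_r + W" "W \<in> n_alg p q"
    using assms(2) by (auto simp: sr_alg_eq)
  have "bracket X Y = t *\<^sub>R bracket A_r W - s *\<^sub>R bracket A_r Z + bracket Z W"
    using bracket_skew[of Z A_r]
    by (simp add: X Y br.add_left br.add_right br.scaleR_left br.scaleR_right bracket_def[of A_r A_r] algebra_simps)
  also have "\<dots> \<in> n_alg p q"
    using X Y A_r_l_alg
    by (intro subspace_add[OF subspace_n_alg] subspace_diff[OF subspace_n_alg] subspace_scale[OF subspace_n_alg]
        bracket_l_n bracket_n_n)
  finally show ?thesis .
qed

lemma chi_r_n_alg:
  assumes "Z \<in> n_alg p q"
  shows "chi_r p q F H Z = Z"
proof -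
  let ?P = "\<lambda>f. f \<in> linear_maps (s_alg p q) (sr_alg p q F H) \<and> (\<forall>Z\<in>n_alg p q. f Z = Z) \<and> f (A0 p q) = A_r"
  \<comment> \<open>The witness shows that the description of \<open>chi_r\<close> is satisfiable.
    \<open>Re (W $ p $ p)\<close> reads off the \<open>A0 p q\<close>-coefficient, since elements of
    n vanish at (p, p).\<close>
  define f where "f = restrict (\<lambda>W. W + Re (W $ p $ p) *\<^sub>R (A_r - A0 p q)) (s_alg p q)"
  have s_eq: "s_alg p q = {t *\<^sub>R A0 p q + Z | t Z. Z \<in> n_alg p q}"
    by (auto simp: s_alg_def a_alg_def)
  have pp: "Z $ p $ p = 0" if "Z \<in> n_alg p q" for Z
    using that by (simp add: n_alg_eq strict_upper_def)
  have s_add: "X + Y \<in> s_alg p q" if XY: "X \<in> s_alg p q" "Y \<in> s_alg p q" for X Y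
  proof -
    obtain t Z s W where "X = t *\<^sub>R A0 p q + Z" "Z \<in> n_alg p q" "Y = s *\<^sub>R A0 p q + W" "W \<in> n_alg p q"
      using XY by (auto simp: s_eq)
    then show ?thesis
      unfolding s_eq
      by (intro CollectI exI[of _ "t + s"] exI[of _ "Z + W"])
         (simp add: scaleR_add_left subspace_add[OF subspace_n_alg])
  qed
  have s_scale: "c *\<^sub>R X \<in> s_alg p q" if X: "X \<in> s_alg p q" for X and c :: real
  proof -
    obtain t Z where "X = t *\<^sub>R A0 p q + Z" "Z \<in> n_alg p q"
      using X by (auto simp: s_eq)
    then show ?thesis
      unfolding s_eq
      by (intro CollectI exI[of _ "c * t"] exI[of _ "c *\<^sub>R Z"])
         (simp add: scaleR_add_right subspace_scale[OF subspace_n_alg])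
  qed
  have n_s: "Z \<in> s_alg p q" if "Z \<in> n_alg p q" for Z
    unfolding s_eq using that by (intro CollectI exI[of _ 0] exI[of _ Z]) simp
  have A0_s: "A0 p q \<in> s_alg p q"
    unfolding s_eq using subspace_0[OF subspace_n_alg] by (intro CollectI exI[of _ 1] exI[of _ 0]) simp
  have "?P f"
  proof (intro conjI ballI)
    show "f Z = Z" if "Z \<in> n_alg p q" for Z
      using pp[OF that] n_s[OF that] by (simp add: f_def)
    show "f (A0 p q) = A_r"
      using A0_s by (simp add: f_def A0_entry)
    have "f W \<in> sr_alg p q F H" if W: "W \<in> s_alg p q" for W
    proof -
      obtain t Z where Z: "W = t *\<^sub>R A0 p q + Z" "Z \<in> n_alg p q"
        using W by (auto simp: s_eq)
      have "f W = t *\<^sub>R A_r + Z"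
        using W pp[OF Z(2)] unfolding f_def by (simp add: Z(1) A0_entry algebra_simps)
      then show ?thesis
        using Z(2) by (auto simp: sr_alg_eq)
    qed
    then show "f \<in> linear_maps (s_alg p q) (sr_alg p q F H)"
      unfolding linear_maps_def using s_add s_scale by (auto simp: f_def algebra_simps)
  qed
  moreover have "g = f" if g: "?P g" for g
  proof
    fix W
    show "g W = f W"
    proof (cases "W \<in> s_alg p q")
      case True
      then obtain t Z where Z: "W = t *\<^sub>R A0 p q + Z" "Z \<in> n_alg p q"
        by (auto simp: s_eq)
      have "e W = t *\<^sub>R A_r + Z" if e: "?P e" for e
      proof -
        have "e W = e (t *\<^sub>R A0 p q) + e Z"
          unfolding Z(1) using e s_scale[OF A0_s] n_s[OF Z(2)] by (simp add: linear_maps_def)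
        also have "e (t *\<^sub>R A0 p q) = t *\<^sub>R e (A0 p q)"
          using e A0_s by (simp add: linear_maps_def)
        finally show ?thesis
          using e Z(2) by simp
      qed
      then show ?thesis
        using g \<open>?P f\<close> by metis
    next
      case False
      then show ?thesis
        using g \<open>?P f\<close> PiE_arb[of g "s_alg p q" "\<lambda>_. sr_alg p q F H" W]
          PiE_arb[of f "s_alg p q" "\<lambda>_. sr_alg p q F H" W] by (simp add: linear_maps_def)
    qed
  qed
  ultimately have "\<exists>!g. ?P g"
    by blast
  then have "?P (chi_r p q F H)"
    unfolding chi_r_def by (rule theI')
  then show ?thesis
    using assms by blast
qed

end

section \<open>The projection to h along the complement M\<close>

locale reductive = nonsymmetric p q F G H for p q :: "'i::finite" and F G H :: "'i cmat set" +
  fixes M :: "'i cmat set"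
  assumes reductive: "reductive_decomposition G H M"
begin

lemma subspace_M: "subspace M" and M_subset: "M \<subseteq> lie_algebra_of G"
  and lie_H_inter_M: "lie_algebra_of H \<inter> M = {0}"
  and lie_G_eq: "lie_algebra_of G = {X + Y | X Y. X \<in> lie_algebra_of H \<and> Y \<in> M}"
  and conj_M: "x \<in> H \<Longrightarrow> Y \<in> M \<Longrightarrow> x ** Y ** matrix_inv x \<in> M"
  using reductive unfolding reductive_decomposition_def by blast+

text \<open>Linearity comes from the reductive decomposition itself, as a sum of two
  subspaces.\<close>

lemma subspace_lie_G: "subspace (lie_algebra_of G)"
  unfolding lie_G_eq by (rule subspace_sums[OF subspace_lie_H subspace_M])

lemma lie_H_subset_lie_G: "lie_algebra_of H \<subseteq> lie_algebra_of G"
  using lie_H_eq lie_F_subset_lie_G by blast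

lemma sr_alg_subset_lie_G: "sr_alg p q F H \<subseteq> lie_algebra_of G"
  unfolding sr_alg_eq using lie_F_subset_lie_G n_alg_subset_lie_G A_r_mem
  by (auto intro!: subspace_add[OF subspace_lie_G] subspace_scale[OF subspace_lie_G])

lemma lie_G_sr_decomp:
  assumes "W \<in> lie_algebra_of G"
  obtains X Y where "X \<in> lie_algebra_of H" "Y \<in> sr_alg p q F H" "W = X + Y"
proof -
  let ?D = "diag_part W"
  define b where "b = Re (?D $ p $ p)"
  have D: "?D \<in> lie_algebra_of F" "W - ?D \<in> n_alg p q"
    using lie_G_decomp[OF assms] by auto
  have "?D - b *\<^sub>R A_r = (?D - b *\<^sub>R A0 p q) - b *\<^sub>R (A_r - A0 p q)"
    by (simp add: algebra_simps)
  also have "\<dots> \<in> suu_alg p q"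
    unfolding b_def using D(1) lie_F_subset A_r_minus_A0
    by (intro suu_alg_diff_scale l_alg_decomp) auto
  finally have "?D - b *\<^sub>R A_r \<in> lie_algebra_of H"
    unfolding lie_H_eq using D(1) A_r_mem
    by (intro IntI subspace_diff[OF F.subspace_lie] subspace_scale[OF F.subspace_lie]) auto
  moreover have "b *\<^sub>R A_r + (W - ?D) \<in> sr_alg p q F H"
    using D(2) by (auto simp: sr_alg_eq)
  ultimately show ?thesis
    by (rule that) simp
qed

lemma h_part_unique:
  assumes "X \<in> lie_algebra_of H" "W - X \<in> M"
  shows "h_part H M W = X"
  unfolding h_part_def
proof (rule the_equality)
  fix X'
  assume X': "X' \<in> lie_algebra_of H \<and> W - X' \<in> M"
  then have "X' - X \<in> lie_algebra_of H" "(W - X) - (W - X') \<in> M"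
    using assms subspace_diff[OF subspace_lie_H] subspace_diff[OF subspace_M] by blast+
  then have "X' - X \<in> lie_algebra_of H \<inter> M"
    by simp
  then show "X' = X"
    using lie_H_inter_M by simp
qed (use assms in blast)

lemma h_part_mem: "W \<in> lie_algebra_of G \<Longrightarrow> h_part H M W \<in> lie_algebra_of H"
  and minus_h_part_mem: "W \<in> lie_algebra_of G \<Longrightarrow> W - h_part H M W \<in> M"
proof -
  assume "W \<in> lie_algebra_of G"
  then obtain X Y where W: "X \<in> lie_algebra_of H" "Y \<in> M" "W = X + Y"
    by (auto simp: lie_G_eq)
  then have "h_part H M W = X"
    by (intro h_part_unique) simp_all
  with W show "h_part H M W \<in> lie_algebra_of H" "W - h_part H M W \<in> M"
    by simp_all
qed

lemma h_part_add:
  assumes "V \<in> lie_algebra_of G" "W \<in> lie_algebra_of G"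
  shows "h_part H M (V + W) = h_part H M V + h_part H M W"
proof (rule h_part_unique)
  show "h_part H M V + h_part H M W \<in> lie_algebra_of H"
    using assms by (intro subspace_add[OF subspace_lie_H] h_part_mem)
  have "(V - h_part H M V) + (W - h_part H M W) \<in> M"
    using assms by (intro subspace_add[OF subspace_M] minus_h_part_mem)
  then show "V + W - (h_part H M V + h_part H M W) \<in> M"
    by (simp add: algebra_simps)
qed

lemma h_part_scale:
  assumes "W \<in> lie_algebra_of G"
  shows "h_part H M (c *\<^sub>R W) = c *\<^sub>R h_part H M W"
proof (rule h_part_unique)
  show "c *\<^sub>R h_part H M W \<in> lie_algebra_of H"
    using assms by (intro subspace_scale[OF subspace_lie_H] h_part_mem)
  have "c *\<^sub>R (W - h_part H M W) \<in> M"
    using assms by (intro subspace_scale[OF subspace_M] minus_h_part_mem)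
  then show "c *\<^sub>R W - c *\<^sub>R h_part H M W \<in> M"
    by (simp add: scaleR_diff_right)
qed

lemma h_part_lie_H: "X \<in> lie_algebra_of H \<Longrightarrow> h_part H M X = X"
  using subspace_0[OF subspace_M] by (intro h_part_unique) simp_all

lemma bracket_lie_H_M:
  assumes "X \<in> lie_algebra_of H" "Y \<in> M"
  shows "bracket X Y \<in> M"
  using conj_M[OF mexp_scale_mem[OF assms(1)] assms(2)]
  by (intro bracket_mem_if_conj_mem[OF subspace_M assms(2)]) simp

lemma h_part_bracket:
  assumes "X \<in> lie_algebra_of H" "Y \<in> lie_algebra_of G"
  shows "h_part H M (bracket X Y) = bracket X (h_part H M Y)"
proof (rule h_part_unique)
  show "bracket X (h_part H M Y) \<in> lie_algebra_of H"
    using assms by (intro bracket_lie_H h_part_mem)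
  have "bracket X (Y - h_part H M Y) \<in> M"
    using assms by (intro bracket_lie_H_M minus_h_part_mem)
  then show "bracket X Y - bracket X (h_part H M Y) \<in> M"
    by (simp add: br.diff_right)
qed

text \<open>The complement is the graph of \<open>- h_part\<close> over \<open>sr_alg\<close>.\<close>

lemma phi_r_eq: "phi_r p q F H M = restrict (\<lambda>Y. - h_part H M Y) (sr_alg p q F H)"
  unfolding phi_r_def
proof (rule the_equality)
  let ?s = "sr_alg p q F H"
  let ?f = "restrict (\<lambda>Y. - h_part H M Y) ?s"
  have g: "Y \<in> lie_algebra_of G" if "Y \<in> ?s" for Y
    using that sr_alg_subset_lie_G by blast
  show "?f \<in> linear_maps ?s (lie_algebra_of H)
     \<and> (\<forall>X\<in>lie_algebra_of H. \<forall>Y\<in>?s. ?f (bracket X Y) = bracket X (?f Y))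
     \<and> M = {Y + ?f Y | Y. Y \<in> ?s}"
  proof (intro conjI ballI)
    show "?f \<in> linear_maps ?s (lie_algebra_of H)"
      unfolding linear_maps_def
      using subspace_add[OF subspace_sr_alg] subspace_scale[OF subspace_sr_alg]
      by (auto simp: g h_part_add h_part_scale intro!: subspace_neg[OF subspace_lie_H] h_part_mem)
    show "?f (bracket X Y) = bracket X (?f Y)" if "X \<in> lie_algebra_of H" "Y \<in> ?s" for X Y
      using that bracket_lie_H_sr[OF that] n_alg_subset_sr_alg
      by (auto simp: g h_part_bracket br.minus_right)
    show "M = {Y + ?f Y | Y. Y \<in> ?s}"
    proof (intro equalityI subsetI)
      fix m
      assume m: "m \<in> M"
      then obtain X Y where XY: "X \<in> lie_algebra_of H" "Y \<in> ?s" "m = X + Y"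
        using M_subset lie_G_sr_decomp by blast
      have "h_part H M Y = - X"
        using XY m by (intro h_part_unique subspace_neg[OF subspace_lie_H]) (simp_all add: add.commute)
      with XY show "m \<in> {Y + ?f Y | Y. Y \<in> ?s}"
        by (intro CollectI exI[of _ Y]) simp
    next
      fix m
      assume "m \<in> {Y + ?f Y | Y. Y \<in> ?s}"
      then show "m \<in> M"
        using minus_h_part_mem[OF g] by auto
    qed
  qed
next
  let ?s = "sr_alg p q F H"
  fix f
  assume f: "f \<in> linear_maps ?s (lie_algebra_of H)
     \<and> (\<forall>X\<in>lie_algebra_of H. \<forall>Y\<in>?s. f (bracket X Y) = bracket X (f Y))
     \<and> M = {Y + f Y | Y. Y \<in> ?s}"
  show "f = restrict (\<lambda>Y. - h_part H M Y) ?s"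
  proof
    fix Y
    show "f Y = restrict (\<lambda>Y. - h_part H M Y) ?s Y"
    proof (cases "Y \<in> ?s")
      case True
      then have fY: "f Y \<in> lie_algebra_of H" "Y + f Y \<in> M"
        using f unfolding linear_maps_def by auto
      have "h_part H M Y = - f Y"
        using fY by (intro h_part_unique subspace_neg[OF subspace_lie_H]) simp_all
      then show ?thesis
        using True by simp
    next
      case False
      then show ?thesis
        using f PiE_arb[of f ?s "\<lambda>_. lie_algebra_of H" Y] by (simp add: linear_maps_def)
    qed
  qed
qed

text \<open>The sign between \<open>phi_r\<close> and \<open>h_part\<close> disappears on the image
  because n is closed under negation; the remaining argument can use \<open>h_part\<close>
  alone.\<close>

lemma phi_r_image_n_alg: "phi_r p q F H M ` n_alg p q = h_part H M ` n_alg p q"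
proof -
  have *: "- h_part H M Z = h_part H M (- Z)" if "Z \<in> n_alg p q" for Z
    using h_part_scale[of Z "-1"] that n_alg_subset_lie_G by auto
  have "phi_r p q F H M ` n_alg p q = (\<lambda>Z. h_part H M (- Z)) ` n_alg p q"
    using n_alg_subset_sr_alg * by (intro image_cong) (auto simp: phi_r_eq)
  also have "\<dots> = h_part H M ` uminus ` n_alg p q"
    by (simp add: image_image)
  also have "uminus ` n_alg p q = n_alg p q"
    using subspace_neg[OF subspace_n_alg] by (force intro: image_eqI[of _ uminus "- x" for x])
  finally show ?thesis .
qed

section \<open>Brackets of the complement and the holonomy algebra\<close>

lemma M_decomp:
  assumes "m \<in> M"
  obtains X Y where "X \<in> lie_algebra_of H" "Y \<in> sr_alg p q F H" "m = X + Y" "h_part H M Y = - X"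
proof -
  obtain X Y where XY: "X \<in> lie_algebra_of H" "Y \<in> sr_alg p q F H" "m = X + Y"
    using assms M_subset lie_G_sr_decomp by blast
  moreover have "h_part H M Y = - X"
    using XY assms by (intro h_part_unique subspace_neg[OF subspace_lie_H]) (simp_all add: add.commute)
  ultimately show ?thesis
    by (rule that)
qed

lemma h_part_bracket_M:
  assumes X: "X \<in> lie_algebra_of H" "h_part H M Y = - X" and Y: "Y \<in> sr_alg p q F H"
    and X': "X' \<in> lie_algebra_of H" "h_part H M Y' = - X'" and Y': "Y' \<in> sr_alg p q F H"
  shows "h_part H M (bracket (X + Y) (X' + Y')) = h_part H M (bracket Y Y' + bracket X Y')"
proof -
  have g: "V \<in> lie_algebra_of G" if "V \<in> n_alg p q" for V
    using that n_alg_subset_lie_G by blast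
  have YG: "Y \<in> lie_algebra_of G" "Y' \<in> lie_algebra_of G"
    using Y Y' sr_alg_subset_lie_G by auto
  have mem: "bracket Y Y' \<in> lie_algebra_of G" "bracket X Y' \<in> lie_algebra_of G"
    "bracket X' Y \<in> lie_algebra_of G" "bracket X X' \<in> lie_algebra_of G"
    using X X' Y Y' bracket_sr_sr bracket_lie_H_sr g bracket_lie_H lie_H_subset_lie_G by blast+
  have "bracket (X + Y) (X' + Y') = (bracket Y Y' + bracket X Y') + ((-1) *\<^sub>R bracket X' Y + bracket X X')"
    using bracket_skew[of Y X'] by (simp add: br.add_left br.add_right algebra_simps)
  then have "h_part H M (bracket (X + Y) (X' + Y')) = h_part H M (bracket Y Y' + bracket X Y')
      + ((-1) *\<^sub>R h_part H M (bracket X' Y) + h_part H M (bracket X X'))"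
    using mem by (simp only: h_part_add h_part_scale subspace_add[OF subspace_lie_G] subspace_scale[OF subspace_lie_G])
  \<comment> \<open>By equivariance the projection of [X', Y] is - [X', X], so its negative cancels
    [X, X']. The mixed term [X, Y'] is deliberately kept, which makes the outcome the projection of
    [Y + X, Y'].\<close>
  also have "(-1) *\<^sub>R h_part H M (bracket X' Y) + h_part H M (bracket X X') = 0"
    using X X' YG bracket_skew[of X' X] bracket_lie_H[of X X']
    by (simp add: h_part_bracket h_part_lie_H br.minus_right)
  finally show ?thesis
    by simp
qed

text \<open>For A in h, equivariance moves a bracket with the projection of Z inside, to the
  projection of [A, Z], and n is h-invariant.\<close>

lemma lie_subalgebra_h_part_image: "lie_subalgebra (h_part H M ` n_alg p q)"
  unfolding lie_subalgebra_def
proof (intro conjI ballI)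
  have g: "V \<in> lie_algebra_of G" if "V \<in> n_alg p q" for V
    using that n_alg_subset_lie_G by blast
  show "subspace (h_part H M ` n_alg p q)"
  proof (rule subspaceI)
    show "0 \<in> h_part H M ` n_alg p q"
      using h_part_lie_H[OF subspace_0[OF subspace_lie_H]] subspace_0[OF subspace_n_alg] by (metis imageI)
    show "A + B \<in> h_part H M ` n_alg p q" if "A \<in> h_part H M ` n_alg p q" "B \<in> h_part H M ` n_alg p q" for A B
      using that g subspace_add[OF subspace_n_alg] by (auto simp flip: h_part_add)
    show "c *\<^sub>R A \<in> h_part H M ` n_alg p q" if "A \<in> h_part H M ` n_alg p q" for c A
      using that g subspace_scale[OF subspace_n_alg] by (auto simp flip: h_part_scale)
  qed
  fix A B
  assume "A \<in> h_part H M ` n_alg p q" "B \<in> h_part H M ` n_alg p q"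
  then obtain Y Z where *: "Y \<in> n_alg p q" "Z \<in> n_alg p q" "A = h_part H M Y" "B = h_part H M Z"
    by blast
  then have A: "A \<in> lie_algebra_of H"
    using g h_part_mem by blast
  then have "bracket A Z \<in> n_alg p q"
    using * lie_H_subset_l_alg bracket_l_n by blast
  moreover have "bracket A B = h_part H M (bracket A Z)"
    using * A g by (simp add: h_part_bracket)
  ultimately show "bracket A B \<in> h_part H M ` n_alg p q"
    by blast
qed

lemma holonomy_algebra_eq: "holonomy_algebra H M = h_part H M ` n_alg p q"
  unfolding holonomy_algebra_def
proof (rule hull_unique)
  let ?S = "{h_part H M (bracket X Y) | X Y. X \<in> M \<and> Y \<in> M}"
  show "?S \<subseteq> h_part H M ` n_alg p q"
  proof
    fix A
    assume "A \<in> ?S"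
    then obtain m m' where A: "A = h_part H M (bracket m m')" "m \<in> M" "m' \<in> M"
      by blast
    obtain X Y where m: "X \<in> lie_algebra_of H" "Y \<in> sr_alg p q F H" "m = X + Y" "h_part H M Y = - X"
      using A(2) by (rule M_decomp)
    obtain X' Y' where m': "X' \<in> lie_algebra_of H" "Y' \<in> sr_alg p q F H" "m' = X' + Y'" "h_part H M Y' = - X'"
      using A(3) by (rule M_decomp)
    have "A = h_part H M (bracket Y Y' + bracket X Y')"
      unfolding A(1) m(3) m'(3) using m m' by (intro h_part_bracket_M)
    moreover have "bracket Y Y' + bracket X Y' \<in> n_alg p q"
      using m m' by (intro subspace_add[OF subspace_n_alg] bracket_sr_sr bracket_lie_H_sr)
    ultimately show "A \<in> h_part H M ` n_alg p q"
      by blast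
  qed
  show "lie_subalgebra (h_part H M ` n_alg p q)"
    by (rule lie_subalgebra_h_part_image)
  fix T
  assume T: "?S \<subseteq> T"
  show "h_part H M ` n_alg p q \<subseteq> T"
  proof
    fix A
    assume "A \<in> h_part H M ` n_alg p q"
    then obtain Z where A: "A = h_part H M Z" "Z \<in> n_alg p q"
      by blast
    \<comment> \<open>This lifts A_r to the element X + A_r of M. It still differs from
      \<open>A0 p q\<close> by an element of s(u(n-1)+u(1)), so [X + A_r, W] = Z is solvable for W
      in n.\<close>
    define X where "X = - h_part H M A_r"
    have A_rG: "A_r \<in> lie_algebra_of G"
      using A_r_mem_sr_alg sr_alg_subset_lie_G by blast
    then have X: "X \<in> lie_algebra_of H" "h_part H M A_r = - X"
      unfolding X_def by (simp_all add: subspace_neg[OF subspace_lie_H] h_part_mem)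
    have "X + (A_r - A0 p q) \<in> suu_alg p q"
      using X(1) A_r_minus_A0 by (intro subspace_add[OF subspace_suu_alg]) (auto simp: lie_H_eq)
    then have "(A_r + X) - A0 p q \<in> suu_alg p q"
      by (simp add: algebra_simps)
    then obtain W where W: "W \<in> n_alg p q" "Z = bracket (A_r + X) W"
      using bracket_image_n_alg A(2) by blast
    \<comment> \<open>W is corrected to an element of M as well; by \<open>h_part_bracket_M\<close>
      the correction does not change the h-part of the bracket, so Z yields a single
      generator.\<close>
    define X' where "X' = - h_part H M W"
    have WG: "W \<in> lie_algebra_of G" and Ws: "W \<in> sr_alg p q F H"
      using W(1) n_alg_subset_lie_G n_alg_subset_sr_alg by auto
    then have X': "X' \<in> lie_algebra_of H" "h_part H M W = - X'"
      unfolding X'_def by (simp_all add: subspace_neg[OF subspace_lie_H] h_part_mem)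
    have "A = h_part H M (bracket (X + A_r) (X' + W))"
      using h_part_bracket_M[OF X A_r_mem_sr_alg X' Ws] by (simp add: A(1) W(2) br.add_left)
    moreover have "X + A_r \<in> M" "X' + W \<in> M"
      using minus_h_part_mem[OF A_rG] minus_h_part_mem[OF WG] by (simp_all add: X_def X'_def)
    ultimately show "A \<in> T"
      using T by blast
  qed
qed

lemma phi_image_n_alg: "phi p q F H M ` n_alg p q = phi_r p q F H M ` n_alg p q"
proof (rule image_cong)
  fix Z
  assume Z: "Z \<in> n_alg p q"
  have "Z \<in> s_alg p q"
    unfolding s_alg_def a_alg_def using Z
    by (intro CollectI exI[of _ 0] exI[of _ Z]) (auto intro: range_eqI[of _ _ 0])
  then show "phi p q F H M Z = phi_r p q F H M Z"
    by (simp add: phi_def compose_def chi_r_n_alg Z)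
qed simp

end

theorem lemma3p1:
  fixes p q :: "'i::finite" and F G H M :: "(complex^'i^'i) set"
  assumes "p \<noteq> q"
    and "nonsymmetric_description p q F G H"
    and "CH_eq_quotient p q G H"
    and "reductive_decomposition G H M"
  shows "holonomy_algebra H M = phi_r p q F H M ` n_alg p q
       \<and> phi_r p q F H M ` n_alg p q = phi p q F H M ` n_alg p q"
proof -
  interpret reductive p q F G H M
    using assms by unfold_locales (auto simp: CH_eq_quotient_def)
  show ?thesis
    by (simp add: holonomy_algebra_eq phi_r_image_n_alg phi_image_n_alg)
qed

end
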